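(* Let $c\in\mathbb C$ be a regular constant, let $n\ge0$ be an integer, write $n=mq+r$ with $q\ge0$, $0\le r\le m-1$, and assume $c\notin\{1,2,\dots,q\}$. Define the linear functional $\varphi$ on the space of homogeneous polynomials of degree $2n$ in $z,\bar z$ by $\varphi(z^n\bar z^n)=1$, $\varphi(z^{n-mk}\bar z^{n+mk})=\varphi(z^{n+mk}\bar z^{n-mk})=(-1)^{mk}\frac{c(c+1)\cdots(c+k-1)}{(1-c)(2-c)\cdots(k-c)}$ for $1\le k\le q$, and $\varphi(z^a\bar z^b)=0$ for all other monomials with $a+b=2n$. Then the degree-$2n$ homogeneous component of the ideal $J_{n+1,c}$ is exactly the kernel of $\varphi$. Equivalently, the standard Frobenius algebra $\mathbb C[z,\bar z]/J_{n+1,c}$ (of degree $2n$) has characteristic polynomial, up to a scalar, $$p_{2n,c}=z^{(n)}\bar z^{(n)}+\sum_{k=1}^q(-1)^{mk}\frac{c(c+1)\cdots(c+k-1)}{(1-c)(2-c)\cdots(k-c)}\big(z^{(n-mk)}\bar z^{(n+mk)}+z^{(n+mk)}\bar z^{(n-mk)}\big),$$ where $x^{(a)}=x^a/a!$.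
   Context: Let $m\ge2$, $\zeta=e^{2\pi i/m}$, and let $z,\bar z$ be independent variables. For $j=0,\dots,m-1$ let $s_j$ be the algebra automorphism of $\mathbb C[z,\bar z]$ with $s_j(z)=-\zeta^j\bar z$, $s_j(\bar z)=-\zeta^{-j}z$. For constant $c$ define Dunkl operators $Y(q)=\frac{\partial q}{\partial z}-c\sum_j\frac{q-s_j(q)}{z+\zeta^j\bar z}$, $\bar Y(q)=\frac{\partial q}{\partial\bar z}-c\sum_j\frac{q-s_j(q)}{\bar z+\zeta^{-j}z}$, $F=-Y\bar Y$; $\mathcal{QH}^{(c)}_{n+1}$ is the space of homogeneous degree-$(n+1)$ polynomials killed by $F$, and $J_{n+1,c}$ is the ideal generated by it. $c$ is regular if there is no nonzero homogeneous polynomial $P$ of positive degree with $Y(P)=\bar Y(P)=0$. The characteristic polynomial of a graded quotient $A=\mathbb C[z,\bar z]/J$ with one-dimensional top degree $N$ is the linear functional on degree-$N$ polynomials with kernel $J_N$, written as the polynomial $\sum_{a+b=N}\varphi(z^a\bar z^b)\,z^{(a)}\bar z^{(b)}$ (divided powers, so that $z^{(a)}\bar z^{(b)}$ is dual to the monomial $z^a\bar z^b$). *)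

theory Defs
  imports Complex_Main "HOL-Computational_Algebra.Polynomial"
begin

text \<open>Polynomials in two independent variables z, zbar over the complex numbers are
represented as elements of type complex poly poly: the outer variable is z, the inner
variable (in the coefficients) is zbar.  The coefficient of the monomial z^a zbar^b of P
is coeff (coeff P a) b.\<close>

type_synonym bipoly = "complex poly poly"

definition cf2 :: "bipoly \<Rightarrow> nat \<Rightarrow> nat \<Rightarrow> complex" where
  "cf2 P a b = coeff (coeff P a) b"

definition const2 :: "complex \<Rightarrow> bipoly" where
  "const2 c = [:[:c:]:]"

definition Zv :: bipoly where "Zv = [:0, 1:]"
definition Zbv :: bipoly where "Zbv = [:[:0, 1:]:]"

definition eval2 :: "bipoly \<Rightarrow> bipoly \<Rightarrow> bipoly \<Rightarrow> bipoly" where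
  "eval2 P X Y = (\<Sum>a\<le>degree P. \<Sum>b\<le>degree (coeff P a). const2 (cf2 P a b) * X ^ a * Y ^ b)"

definition dz :: "bipoly \<Rightarrow> bipoly" where "dz P = pderiv P"
definition dzb :: "bipoly \<Rightarrow> bipoly" where "dzb P = map_poly pderiv P"

definition zeta :: "nat \<Rightarrow> complex" where
  "zeta m = cis (2 * pi / real m)"

definition refl_s :: "nat \<Rightarrow> nat \<Rightarrow> bipoly \<Rightarrow> bipoly" where
  "refl_s m j P = eval2 P (const2 (- (zeta m ^ j)) * Zbv) (const2 (- inverse (zeta m ^ j)) * Zv)"

text \<open>Dunkl operators (the divisions are exact).\<close>
definition DunklY :: "nat \<Rightarrow> complex \<Rightarrow> bipoly \<Rightarrow> bipoly" where
  "DunklY m c P = dz P - const2 c *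
     (\<Sum>j<m. (P - refl_s m j P) div (Zv + const2 (zeta m ^ j) * Zbv))"

definition DunklYb :: "nat \<Rightarrow> complex \<Rightarrow> bipoly \<Rightarrow> bipoly" where
  "DunklYb m c P = dzb P - const2 c *
     (\<Sum>j<m. (P - refl_s m j P) div (Zbv + const2 (inverse (zeta m ^ j)) * Zv))"

definition DunklF :: "nat \<Rightarrow> complex \<Rightarrow> bipoly \<Rightarrow> bipoly" where
  "DunklF m c P = - DunklY m c (DunklYb m c P)"

definition homog :: "nat \<Rightarrow> bipoly \<Rightarrow> bool" where
  "homog d P \<longleftrightarrow> (\<forall>a b. cf2 P a b \<noteq> 0 \<longrightarrow> a + b = d)"

definition QH :: "nat \<Rightarrow> complex \<Rightarrow> nat \<Rightarrow> bipoly set" where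
  "QH m c d = {P. homog d P \<and> DunklF m c P = 0}"

definition gen_ideal :: "bipoly set \<Rightarrow> bipoly set" where
  "gen_ideal S = {P. \<exists>(k::nat) g h. (\<forall>i<k. h i \<in> S) \<and> P = (\<Sum>i<k. g i * h i)}"

definition Jideal :: "nat \<Rightarrow> complex \<Rightarrow> nat \<Rightarrow> bipoly set" where
  "Jideal m c d = gen_ideal (QH m c d)"

definition regular_const :: "nat \<Rightarrow> complex \<Rightarrow> bool" where
  "regular_const m c \<longleftrightarrow> \<not> (\<exists>P d. d > 0 \<and> homog d P \<and> P \<noteq> 0 \<and>
        DunklY m c P = 0 \<and> DunklYb m c P = 0)"

definition phi_val :: "nat \<Rightarrow> complex \<Rightarrow> nat \<Rightarrow> complex" where
  "phi_val m c k = (-1) ^ (m * k) * pochhammer c k / (\<Prod>i=1..k. (of_nat i - c))"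

text \<open>Value of phi on the monomial z^a zbar^(2n-a).\<close>
definition phi_mono :: "nat \<Rightarrow> complex \<Rightarrow> nat \<Rightarrow> nat \<Rightarrow> complex" where
  "phi_mono m c n a =
     (if a = n then 1
      else if (\<exists>k. 1 \<le> k \<and> k \<le> n div m \<and> (a = n + m * k \<or> a + m * k = n))
        then phi_val m c (THE k. 1 \<le> k \<and> k \<le> n div m \<and> (a = n + m * k \<or> a + m * k = n))
      else 0)"

definition phi :: "nat \<Rightarrow> complex \<Rightarrow> nat \<Rightarrow> bipoly \<Rightarrow> complex" where
  "phi m c n P = (\<Sum>a\<le>2 * n. cf2 P a (2 * n - a) * phi_mono m c n a)"

end

theory Submission
  imports Defs
    "HOL-Computational_Algebra.Field_as_Ring"
    "HOL-Computational_Algebra.Polynomial_Factorial"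
    "HOL-Computational_Algebra.Fundamental_Theorem_Algebra"
begin

text \<open>Put \<open>N = n + 1\<close> and \<open>Q = N div m\<close>. On coefficient sequences the Dunkl operators become explicit, and the
  kernels of \<open>Ybar\<close> and \<open>Y\<close> in degree \<open>N\<close> are lines, spanned by a Heisenberg polynomial \<open>f\<close> in
  \<open>z^m, (-zbar)^m\<close> (times \<open>z^(N mod m)\<close>) and by its mirror image \<open>g\<close>. Since \<open>Ybar\<close> maps \<open>g\<close> to a multiple
  of the mirror polynomial of degree \<open>n\<close>, with a factor that regularity keeps nonzero, the
  quasi-harmonic space is spanned by \<open>f\<close> and \<open>g\<close>. The functional kills all products of \<open>f\<close> and \<open>g\<close>
  with polynomials of degree \<open>n - 1\<close>, by a recurrence in \<open>Q\<close> whose boundary case is the Vandermonde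
  convolution. The same recurrence shows that \<open>f\<close> and \<open>g\<close> have no common zero, so these products
  fill a hyperplane in degree \<open>2n\<close>, which must be the kernel of the functional.\<close>

section \<open>Dunkl operators on homogeneous polynomials\<close>

lemma bipoly_eqI: "(\<And>a b. cf2 P a b = cf2 Q a b) \<Longrightarrow> P = Q"
  by (auto simp: cf2_def poly_eq_iff)

lemma cf2_add [simp]: "cf2 (P + Q) a b = cf2 P a b + cf2 Q a b"
  and cf2_diff [simp]: "cf2 (P - Q) a b = cf2 P a b - cf2 Q a b"
  and cf2_zero [simp]: "cf2 0 a b = 0"
  by (simp_all add: cf2_def)

lemma cf2_sum [simp]: "cf2 (\<Sum>i\<in>I. P i) a b = (\<Sum>i\<in>I. cf2 (P i) a b)"
  by (simp add: cf2_def coeff_sum)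

lemma cf2_const2_mult [simp]: "cf2 (const2 t * P) a b = t * cf2 P a b"
  by (simp add: cf2_def const2_def)

lemma cf2_Zv_mult [simp]: "cf2 (Zv * P) a b = (if a = 0 then 0 else cf2 P (a - 1) b)"
  by (cases a) (simp_all add: cf2_def Zv_def)

lemma cf2_Zbv_mult [simp]: "cf2 (Zbv * P) a b = (if b = 0 then 0 else cf2 P a (b - 1))"
  by (cases b) (simp_all add: cf2_def Zbv_def)

lemma cf2_monom2_mult:
  "cf2 (monom (monom x j) i * P) a b = (if i \<le> a \<and> j \<le> b then x * cf2 P (a - i) (b - j) else 0)"
  by (auto simp: cf2_def coeff_monom_mult)

lemma const2_mult: "const2 s * const2 t = const2 (s * t)"
  by (simp add: const2_def)

lemma const2_1: "const2 1 = 1" by (simp add: const2_def one_pCons)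

text \<open>A form of degree \<open>N\<close> is encoded by its coefficients, indexed by the
  exponent of z. Only entries up to \<open>N\<close> count, so identities of sequences are stated
  for \<open>a \<le> N\<close>.\<close>

definition hom :: "nat \<Rightarrow> (nat \<Rightarrow> complex) \<Rightarrow> bipoly" where
  "hom N p = (\<Sum>a\<le>N. monom (monom (p a) (N - a)) a)"

lemma cf2_hom: "cf2 (hom N p) a b = (if a + b = N then p a else 0)"
proof -
  have "cf2 (hom N p) a b = (\<Sum>i\<le>N. if i = a then (if N - a = b then p a else 0) else 0)"
    by (auto simp: hom_def cf2_def coeff_sum intro!: sum.cong)
  then show ?thesis by auto
qed

lemma homog_hom: "homog N (hom N p)"
  by (auto simp: homog_def cf2_hom split: if_splits)

lemma homog_eq_hom: "homog N P \<Longrightarrow> P = hom N (\<lambda>a. cf2 P a (N - a))"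
  by (rule bipoly_eqI) (force simp: homog_def cf2_hom)

lemma hom_eq_iff: "hom N p = hom N q \<longleftrightarrow> (\<forall>a\<le>N. p a = q a)"
proof
  show "\<forall>a\<le>N. p a = q a" if "hom N p = hom N q"
  proof (intro allI impI)
    fix a assume "a \<le> N"
    then show "p a = q a"
      using arg_cong[OF that, of "\<lambda>P. cf2 P a (N - a)"] by (simp add: cf2_hom)
  qed
  show "hom N p = hom N q" if "\<forall>a\<le>N. p a = q a"
    using that by (intro bipoly_eqI) (auto simp: cf2_hom)
qed

lemma hom_cong: "(\<And>a. a \<le> N \<Longrightarrow> p a = q a) \<Longrightarrow> hom N p = hom N q"
  by (simp add: hom_eq_iff)

lemma hom_zero [simp]: "hom N (\<lambda>_. 0) = 0"
  by (rule bipoly_eqI) (simp add: cf2_hom)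

lemma hom_eq_0_iff: "hom N p = 0 \<longleftrightarrow> (\<forall>a\<le>N. p a = 0)"
  using hom_eq_iff[of N p "\<lambda>_. 0"] by simp

lemma const2_mult_hom: "const2 t * hom N p = hom N (\<lambda>a. t * p a)"
  by (rule bipoly_eqI) (simp add: cf2_hom)

lemma hom_add: "hom N p + hom N q = hom N (\<lambda>a. p a + q a)"
  by (rule bipoly_eqI) (simp add: cf2_hom)

lemma hom_diff: "hom N p - hom N q = hom N (\<lambda>a. p a - q a)"
  by (rule bipoly_eqI) (simp add: cf2_hom)

lemma hom_sum: "(\<Sum>i\<in>I. hom N (p i)) = hom N (\<lambda>a. \<Sum>i\<in>I. p i a)"
  by (rule bipoly_eqI) (simp add: cf2_hom)

text \<open>Setting zbar = 1 is multiplicative. This carries the ideal over to polynomials in one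
  variable; the degree bounds ensure that \<open>hom\<close> truncates nothing.\<close>

lemma hom_mult_coeff:
  assumes "degree F \<le> N" "degree G \<le> K"
  shows "hom N (coeff F) * hom K (coeff G) = hom (N + K) (coeff (F * G))"
proof (rule bipoly_eqI)
  fix a b
  have "cf2 (hom N (coeff F) * hom K (coeff G)) a b
      = (\<Sum>i\<le>a. \<Sum>j\<le>b. cf2 (hom N (coeff F)) i j * cf2 (hom K (coeff G)) (a - i) (b - j))"
    by (simp add: cf2_def coeff_mult coeff_sum)
  also have "\<dots> = (\<Sum>i\<le>a. if a + b = N + K then coeff F i * coeff G (a - i) else 0)"
  proof (rule sum.cong)
    fix i assume i: "i \<in> {..a}"
    have t: "cf2 (hom N (coeff F)) i j * cf2 (hom K (coeff G)) (a - i) (b - j)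
        = (if j = N - i then (if i \<le> N \<and> a - i + (b - (N - i)) = K then coeff F i * coeff G (a - i) else 0) else 0)" for j
      unfolding cf2_hom by (cases "i + j = N") auto
    have "(\<Sum>j\<le>b. cf2 (hom N (coeff F)) i j * cf2 (hom K (coeff G)) (a - i) (b - j))
        = (if N - i \<le> b then (if i \<le> N \<and> a - i + (b - (N - i)) = K then coeff F i * coeff G (a - i) else 0) else 0)"
      unfolding t by (simp only: sum.delta finite_atMost atMost_iff)
    also have "\<dots> = (if a + b = N + K then coeff F i * coeff G (a - i) else 0)"
    \<comment> \<open>For nonzero coefficients the degree bounds make the natural subtractions
      exact; otherwise both sides vanish.\<close>
    proof (cases "coeff F i = 0 \<or> coeff G (a - i) = 0")
      case False
      then have "i \<le> N" "a - i \<le> K" using assms le_degree le_trans by blast+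
      then have "N - i \<le> b \<and> i \<le> N \<and> a - i + (b - (N - i)) = K \<longleftrightarrow> a + b = N + K"
        using i unfolding atMost_iff by linarith
      then show ?thesis by argo
    next
      case True
      then have "coeff F i * coeff G (a - i) = 0" by simp
      then show ?thesis by (simp only: if_cancel)
    qed
    finally show "(\<Sum>j\<le>b. cf2 (hom N (coeff F)) i j * cf2 (hom K (coeff G)) (a - i) (b - j))
      = (if a + b = N + K then coeff F i * coeff G (a - i) else 0)" .
  qed simp
  also have "\<dots> = cf2 (hom (N + K) (coeff (F * G))) a b"
    by (simp add: cf2_hom coeff_mult)
  finally show "cf2 (hom N (coeff F) * hom K (coeff G)) a b = cf2 (hom (N + K) (coeff (F * G))) a b" .
qed

section \<open>Reflections and exact difference quotients\<close>

lemma const2_eq_0 [simp]: "const2 0 = 0" by (simp add: const2_def)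

lemma const2_power: "const2 t ^ k = const2 (t ^ k)"
  by (induction k) (simp_all add: const2_mult const2_1)

lemma cf2_monomial: "cf2 (const2 t * Zbv ^ j * Zv ^ i) a b = (if a = i \<and> b = j then t else 0)"
proof -
  have "cf2 (Zbv ^ j * Zv ^ i) a b = (if a = i \<and> b = j then 1 else 0)" for a b
  proof (induction j arbitrary: b)
    case 0
    then show ?case
    proof (induction i arbitrary: a)
      case 0
      then show ?case by (auto simp: cf2_def one_pCons coeff_pCons split: nat.splits)
    next
      case (Suc i)
      then show ?case by auto
    qed
  next
    case (Suc j)
    then show ?case by (auto simp: mult.assoc)
  qed
  then show ?thesis by (simp add: mult.assoc)
qed

lemma eval2_hom: "eval2 (hom N p) X Y = (\<Sum>a\<le>N. const2 (p a) * X ^ a * Y ^ (N - a))"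
proof -
  let ?P = "hom N p"
  have in_range: "(\<Sum>b\<le>degree (coeff ?P a). const2 (cf2 ?P a b) * X ^ a * Y ^ b)
    = (if a \<le> N then const2 (p a) * X ^ a * Y ^ (N - a) else 0)" for a
  proof -
    have "(\<Sum>b\<le>degree (coeff ?P a). const2 (cf2 ?P a b) * X ^ a * Y ^ b)
      = (\<Sum>b\<le>degree (coeff ?P a) + N. const2 (cf2 ?P a b) * X ^ a * Y ^ b)"
      by (rule sum.mono_neutral_left) (auto simp: cf2_def coeff_eq_0)
    also have "\<dots> = (\<Sum>b\<le>degree (coeff ?P a) + N. if b = N - a then (if a \<le> N then const2 (p a) * X ^ a * Y ^ (N - a) else 0) else 0)"
      by (rule sum.cong) (auto simp: cf2_hom)
    also have "\<dots> = (if a \<le> N then const2 (p a) * X ^ a * Y ^ (N - a) else 0)"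
    proof -
      have "N - a \<le> degree (coeff ?P a) + N" by (rule trans_le_add2) simp
      then show ?thesis by simp
    qed
    finally show ?thesis .
  qed
  have "eval2 ?P X Y = (\<Sum>a\<le>degree ?P. if a \<le> N then const2 (p a) * X ^ a * Y ^ (N - a) else 0)"
    unfolding eval2_def in_range ..
  also have "\<dots> = (\<Sum>a\<le>degree ?P + N. if a \<le> N then const2 (p a) * X ^ a * Y ^ (N - a) else 0)"
  proof (rule sum.mono_neutral_left; (intro ballI)?)
    fix a assume "a \<in> {..degree ?P + N} - {..degree ?P}"
    then have "coeff ?P a = 0" by (simp add: coeff_eq_0)
    then have "a \<le> N \<Longrightarrow> p a = 0" using cf2_hom[of N p a "N - a"] by (simp add: cf2_def)
    then show "(if a \<le> N then const2 (p a) * X ^ a * Y ^ (N - a) else 0) = 0" by simp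
  qed auto
  also have "\<dots> = (\<Sum>a\<le>N. const2 (p a) * X ^ a * Y ^ (N - a))"
    by (rule sum.mono_neutral_cong_right) auto
  finally show ?thesis .
qed

text \<open>With \<open>x = xi m j\<close> the reflection sends z to x zbar and zbar to z / x, and
  the denominator in \<open>DunklY\<close> is z - x zbar.\<close>

abbreviation xi :: "nat \<Rightarrow> nat \<Rightarrow> complex" where "xi m j \<equiv> - (zeta m ^ j)"

lemma zeta_nonzero [simp]: "zeta m \<noteq> 0" by (simp add: zeta_def)

lemma refl_s_hom:
  "refl_s m j (hom N p) = hom N (\<lambda>i. p (N - i) * xi m j ^ (N - i) * inverse (xi m j) ^ i)"
proof -
  let ?x = "xi m j"
  have y: "- inverse (zeta m ^ j) = inverse ?x" by simp
  have "refl_s m j (hom N p) = (\<Sum>a\<le>N. const2 (p a * ?x ^ a * inverse ?x ^ (N - a)) * Zbv ^ a * Zv ^ (N - a))"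
    unfolding refl_s_def eval2_hom y power_mult_distrib const2_power
    by (rule sum.cong) (simp_all add: const2_mult[symmetric] mult_ac)
  also have "\<dots> = hom N (\<lambda>i. p (N - i) * ?x ^ (N - i) * inverse ?x ^ i)" (is "?L = ?R")
  proof (rule bipoly_eqI)
    fix a b
    have "cf2 ?L a b = (\<Sum>i\<le>N. if i = b then (if a + b = N then p b * ?x ^ b * inverse ?x ^ a else 0) else 0)"
      unfolding cf2_sum cf2_monomial by (rule sum.cong) auto
    then show "cf2 ?L a b = cf2 ?R a b" by (auto simp: cf2_hom)
  qed
  finally show ?thesis .
qed

text \<open>With \<open>x = - zeta^j\<close>, the coefficients of the quotient of \<open>P - s_j P\<close> by \<open>z - x zbar\<close>. They are found by
  reading the division recurrence from \<open>z^0\<close> upwards, so that its verification telescopes.\<close>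
definition dquot :: "complex \<Rightarrow> nat \<Rightarrow> (nat \<Rightarrow> complex) \<Rightarrow> nat \<Rightarrow> complex" where
  "dquot x N p a = inverse x ^ (a + 1) * (\<Sum>i\<le>a. p (N - i) * x ^ (N - i) - p i * x ^ i)"

lemma dquot_telescope:
  assumes x: "x \<noteq> 0" and a: "a \<le> Suc N"
  shows "(if a = 0 then 0 else dquot x (Suc N) p (a - 1)) - (if a = Suc N then 0 else x * dquot x (Suc N) p a)
    = p a - p (Suc N - a) * x ^ (Suc N - a) * inverse x ^ a"
proof -
  let ?S = "\<lambda>k. \<Sum>i<k. p (Suc N - i) * x ^ (Suc N - i) - p i * x ^ i"
  \<comment> \<open>Reversing the order of summation exchanges the two terms. This vanishing is what
    makes the division exact.\<close>
  have sum0: "?S (Suc (Suc N)) = 0"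
  proof -
    have "(\<Sum>i<Suc (Suc N). p (Suc N - i) * x ^ (Suc N - i)) = (\<Sum>i<Suc (Suc N). p i * x ^ i)"
      by (subst sum.nat_diff_reindex[symmetric]) simp
    then show ?thesis unfolding sum_subtractf by simp
  qed
  have 1: "(if a = 0 then 0 else dquot x (Suc N) p (a - 1)) = inverse x ^ a * ?S a"
    by (cases a) (simp_all add: dquot_def lessThan_Suc_atMost)
  have 2: "(if a = Suc N then 0 else x * dquot x (Suc N) p a) = inverse x ^ a * ?S (Suc a)"
  proof (cases "a = Suc N")
    case True
    then show ?thesis using sum0 by simp
  next
    case False
    then show ?thesis using x by (simp add: dquot_def lessThan_Suc_atMost field_simps)
  qed
  have "inverse x ^ a * x ^ a = 1" using x by (simp add: power_mult_distrib[symmetric])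
  then show ?thesis unfolding 1 2 by (simp add: algebra_simps)
qed

lemma refl_s_quotient:
  "hom (Suc N) p - refl_s m j (hom (Suc N) p)
    = (Zv + const2 (zeta m ^ j) * Zbv) * hom N (dquot (xi m j) (Suc N) p)"
proof (rule bipoly_eqI)
  fix a b
  let ?x = "xi m j"
  have x: "?x \<noteq> 0" by simp
  show "cf2 (hom (Suc N) p - refl_s m j (hom (Suc N) p)) a b
    = cf2 ((Zv + const2 (zeta m ^ j) * Zbv) * hom N (dquot ?x (Suc N) p)) a b"
  proof (cases "a + b = Suc N")
    case True
    then have b: "b = Suc N - a" and a: "a \<le> Suc N" by auto
    have "cf2 ((Zv + const2 (zeta m ^ j) * Zbv) * hom N (dquot ?x (Suc N) p)) a b
      = (if a = 0 then 0 else dquot ?x (Suc N) p (a - 1)) - (if a = Suc N then 0 else ?x * dquot ?x (Suc N) p a)"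
      using True by (auto simp: distrib_right mult.assoc cf2_hom)
    also have "\<dots> = p a - p (Suc N - a) * ?x ^ (Suc N - a) * inverse ?x ^ a"
      by (rule dquot_telescope[OF x a])
    finally show ?thesis using True by (simp add: refl_s_hom cf2_hom)
  next
    case False
    then show ?thesis by (auto simp: refl_s_hom cf2_hom distrib_right mult.assoc)
  qed
qed

lemma refl_div_Y:
  "(hom (Suc N) p - refl_s m j (hom (Suc N) p)) div (Zv + const2 (zeta m ^ j) * Zbv)
    = hom N (dquot (xi m j) (Suc N) p)"
proof -
  have "cf2 (Zv + const2 (zeta m ^ j) * Zbv) 1 0 = 1"
    by (simp add: cf2_def Zv_def Zbv_def const2_def one_pCons)
  then have "Zv + const2 (zeta m ^ j) * Zbv \<noteq> 0" by (metis cf2_zero zero_neq_one)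
  then show ?thesis unfolding refl_s_quotient by simp
qed

text \<open>The denominator of \<open>DunklYb\<close> is that of \<open>DunklY\<close> divided by
  \<open>zeta m ^ j\<close>, so the quotient gains the factor
  \<open>zeta m ^ j = - xi m j\<close>.\<close>

lemma refl_div_Yb:
  "(hom (Suc N) p - refl_s m j (hom (Suc N) p)) div (Zbv + const2 (inverse (zeta m ^ j)) * Zv)
    = hom N (\<lambda>a. - xi m j * dquot (xi m j) (Suc N) p a)"
proof -
  let ?z = "zeta m ^ j"
  have "cf2 (Zbv + const2 (inverse ?z) * Zv) 0 1 = 1"
    by (simp add: cf2_def Zv_def Zbv_def const2_def)
  then have nz: "Zbv + const2 (inverse ?z) * Zv \<noteq> 0" by (metis cf2_zero zero_neq_one)
  have "const2 ?z * const2 (inverse ?z) = 1" by (simp add: const2_mult const2_1)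
  then have "Zv + const2 ?z * Zbv = (Zbv + const2 (inverse ?z) * Zv) * const2 ?z"
    by (simp add: algebra_simps)
  then show ?thesis unfolding refl_s_quotient using nz
    by (simp add: mult.assoc const2_mult_hom)
qed

lemma refl_s_hom_0: "refl_s m j (hom 0 p) = hom 0 p"
  by (simp add: refl_s_hom hom_eq_iff)

section \<open>Averaging over the reflections\<close>

definition chi :: "nat \<Rightarrow> nat \<Rightarrow> nat \<Rightarrow> complex" where
  "chi m a t = (if a mod m = t mod m then (-1) ^ (a + t) else 0)"

lemma zeta_power_m: "m > 0 \<Longrightarrow> zeta m ^ m = 1"
  by (simp add: zeta_def DeMoivre)

lemma zeta_power_eq_1_iff:
  assumes "m > 0"
  shows "zeta m ^ k = 1 \<longleftrightarrow> m dvd k"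
proof
  assume "zeta m ^ k = 1"
  then have "cis (real k * (2 * pi / real m)) = 1" by (simp add: zeta_def DeMoivre)
  then have "cos (real k * (2 * pi / real m)) = 1"
    by (metis cis.simps(1) one_complex.simps(1))
  then obtain i :: int where "real k * (2 * pi / real m) = real_of_int i * 2 * pi"
    using cos_one_2pi_int by blast
  then have "real k = real_of_int i * real m" using assms by (simp add: field_simps)
  then have "real_of_int (int k) = real_of_int (i * int m)" by simp
  then have "int k = i * int m" by (simp only: of_int_eq_iff)
  then have "int m dvd int k" by simp
  then show "m dvd k" by simp
next
  assume "m dvd k"
  then show "zeta m ^ k = 1" using zeta_power_m[OF assms] by (auto simp: power_mult)
qed

text \<open>Orthogonality of roots of unity: the summand is a sign times the \<open>j\<close>-th
  power of an \<open>m\<close>-th root of unity \<open>w\<close>, whose geometric sum vanishes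
  unless \<open>w = 1\<close>. The sign comes from \<open>xi m j = - (zeta m ^ j)\<close>.\<close>

lemma xi_power_sum:
  assumes m: "m > 0"
  shows "(\<Sum>j<m. xi m j ^ a * inverse (xi m j) ^ t) = of_nat m * chi m a t"
proof -
  define w where "w = zeta m ^ a * inverse (zeta m) ^ t"
  have pow: "xi m j ^ a * inverse (xi m j) ^ t = (-1) ^ (a + t) * w ^ j" for j
  proof -
    have "xi m j ^ a = (-1) ^ a * (zeta m ^ a) ^ j"
      by (subst power_minus) (simp add: power_mult[symmetric] mult.commute)
    moreover have "inverse (xi m j) ^ t = (-1) ^ t * (inverse (zeta m) ^ t) ^ j"
      by (subst inverse_minus_eq, subst power_minus)
        (simp add: power_mult[symmetric] mult.commute power_inverse)
    ultimately show ?thesis by (simp add: w_def power_mult_distrib power_add)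
  qed
  have wm: "w ^ m = 1"
  proof -
    have "w ^ m = (zeta m ^ m) ^ a * inverse ((zeta m ^ m) ^ t)"
      by (simp add: w_def power_mult_distrib power_mult[symmetric] mult.commute power_inverse)
    then show ?thesis by (simp add: zeta_power_m[OF m])
  qed
  have w1: "w = 1 \<longleftrightarrow> a mod m = t mod m"
  proof -
    have eq: "w = 1 \<longleftrightarrow> zeta m ^ a = zeta m ^ t"
      by (simp add: w_def power_inverse field_simps)
    have aux: "zeta m ^ a' = zeta m ^ t' \<longleftrightarrow> a' mod m = t' mod m" if "a' \<le> t'" for a' t'
    proof -
      have "zeta m ^ t' = zeta m ^ a' * zeta m ^ (t' - a')" using that by (simp add: power_add[symmetric])
      then have "zeta m ^ a' = zeta m ^ t' \<longleftrightarrow> m dvd t' - a'"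
        using zeta_power_eq_1_iff[OF m, of "t' - a'"] by auto
      then show ?thesis using that mod_eq_dvd_iff_nat by metis
    qed
    show ?thesis unfolding eq using aux[of a t] aux[of t a] by (metis linear)
  qed
  have "(\<Sum>j<m. xi m j ^ a * inverse (xi m j) ^ t) = (-1) ^ (a + t) * (\<Sum>j<m. w ^ j)"
    unfolding pow by (simp add: sum_distrib_left)
  also have "(\<Sum>j<m. w ^ j) = (if w = 1 then of_nat m else 0)"
    using wm geometric_sum[of w m] by auto
  finally show ?thesis by (auto simp: chi_def w1)
qed

lemma dquot_sum:
  assumes m: "m > 0"
  shows "(\<Sum>j<m. dquot (xi m j) N p a)
    = of_nat m * (\<Sum>i\<le>a. chi m (N - i) (a + 1) * p (N - i) - chi m i (a + 1) * p i)"
proof -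
  have "(\<Sum>j<m. dquot (xi m j) N p a)
    = (\<Sum>i\<le>a. \<Sum>j<m. p (N - i) * (xi m j ^ (N - i) * inverse (xi m j) ^ (a + 1)) - p i * (xi m j ^ i * inverse (xi m j) ^ (a + 1)))"
    unfolding dquot_def sum_distrib_left
    by (subst sum.swap) (simp add: algebra_simps del: power_Suc)
  also have "\<dots> = of_nat m * (\<Sum>i\<le>a. chi m (N - i) (a + 1) * p (N - i) - chi m i (a + 1) * p i)"
    unfolding sum_subtractf sum_distrib_left[symmetric] xi_power_sum[OF m]
    by (simp add: sum_distrib_left algebra_simps)
  finally show ?thesis .
qed

text \<open>The additional factor \<open>xi m j\<close> cancels one power of its inverse in
  \<open>dquot\<close>, so the selected residue class is that of \<open>a\<close> instead of
  \<open>a + 1\<close>.\<close>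

lemma xi_dquot_sum:
  assumes m: "m > 0"
  shows "(\<Sum>j<m. - xi m j * dquot (xi m j) N p a)
    = of_nat m * (\<Sum>i\<le>a. chi m i a * p i - chi m (N - i) a * p (N - i))"
proof -
  have x: "xi m j * (inverse (xi m j) ^ (a + 1) * s) = inverse (xi m j) ^ a * s" for j s
  proof -
    have "xi m j * inverse (xi m j) = 1" by simp
    then show ?thesis unfolding power_add by (metis mult.assoc mult.commute mult_1 power_one_right)
  qed
  have "(\<Sum>j<m. xi m j * dquot (xi m j) N p a)
    = (\<Sum>i\<le>a. \<Sum>j<m. p (N - i) * (xi m j ^ (N - i) * inverse (xi m j) ^ a) - p i * (xi m j ^ i * inverse (xi m j) ^ a))"
    unfolding dquot_def x unfolding sum_distrib_left
    by (subst sum.swap) (simp add: algebra_simps)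
  also have "\<dots> = of_nat m * (\<Sum>i\<le>a. chi m (N - i) a * p (N - i) - chi m i a * p i)"
    unfolding sum_subtractf sum_distrib_left[symmetric] xi_power_sum[OF m]
    by (simp add: sum_distrib_left algebra_simps)
  finally have "- (\<Sum>j<m. xi m j * dquot (xi m j) N p a)
    = - (of_nat m * (\<Sum>i\<le>a. chi m (N - i) a * p (N - i) - chi m i a * p i))" by (rule arg_cong)
  then show ?thesis
    by (simp add: sum_negf sum_subtractf algebra_simps)
qed

section \<open>The operators on coefficient sequences\<close>

lemma dz_hom: "dz (hom (Suc N) p) = hom N (\<lambda>a. of_nat (a + 1) * p (a + 1))"
proof (rule bipoly_eqI)
  fix a b
  have n: "coeff (of_nat k * q) i = of_nat k * coeff q i" for k i and q :: "complex poly"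
    by (induction k) (simp_all add: algebra_simps)
  have "cf2 (dz P) a b = of_nat (a + 1) * cf2 P (a + 1) b" for P
    by (simp add: dz_def cf2_def coeff_pderiv n del: of_nat_Suc)
  then show "cf2 (dz (hom (Suc N) p)) a b = cf2 (hom N (\<lambda>a. of_nat (a + 1) * p (a + 1))) a b"
    by (simp add: cf2_hom)
qed

lemma dzb_hom: "dzb (hom (Suc N) p) = hom N (\<lambda>a. of_nat (Suc N - a) * p a)"
proof (rule bipoly_eqI)
  fix a b
  have "cf2 (dzb P) a b = of_nat (b + 1) * cf2 P a (b + 1)" for P
    by (simp add: dzb_def cf2_def coeff_map_poly coeff_pderiv)
  then show "cf2 (dzb (hom (Suc N) p)) a b = cf2 (hom N (\<lambda>a. of_nat (Suc N - a) * p a)) a b"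
    by (auto simp: cf2_hom)
qed

text \<open>The operators \<open>Y\<close> and \<open>Ybar\<close> from degree \<open>N + 1\<close> to degree \<open>N\<close>, on coefficient sequences.\<close>
definition Yc :: "nat \<Rightarrow> complex \<Rightarrow> nat \<Rightarrow> (nat \<Rightarrow> complex) \<Rightarrow> nat \<Rightarrow> complex" where
  "Yc m c N p a = of_nat (a + 1) * p (a + 1)
     + c * of_nat m * (\<Sum>i\<le>a. chi m i (a + 1) * p i - chi m (Suc N - i) (a + 1) * p (Suc N - i))"

definition Ybc :: "nat \<Rightarrow> complex \<Rightarrow> nat \<Rightarrow> (nat \<Rightarrow> complex) \<Rightarrow> nat \<Rightarrow> complex" where
  "Ybc m c N p a = of_nat (Suc N - a) * p a
     - c * of_nat m * (\<Sum>i\<le>a. chi m i a * p i - chi m (Suc N - i) a * p (Suc N - i))"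

lemma DunklY_hom:
  assumes "m > 0"
  shows "DunklY m c (hom (Suc N) p) = hom N (Yc m c N p)"
  unfolding DunklY_def refl_div_Y dz_hom hom_sum const2_mult_hom hom_diff dquot_sum[OF assms] Yc_def
  by (rule hom_cong) (simp add: sum_subtractf algebra_simps)

lemma DunklYb_hom:
  assumes "m > 0"
  shows "DunklYb m c (hom (Suc N) p) = hom N (Ybc m c N p)"
  unfolding DunklYb_def refl_div_Yb dzb_hom hom_sum const2_mult_hom hom_diff
    xi_dquot_sum[OF assms] Ybc_def
  by (rule hom_cong) (simp add: sum_subtractf algebra_simps)

lemma DunklY_hom_0: "DunklY m c (hom 0 p) = 0"
  unfolding DunklY_def refl_s_hom_0 by (simp add: dz_def hom_def monom_0 pderiv_pCons)

section \<open>The kernels of the Dunkl operators\<close>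

definition hc :: "complex \<Rightarrow> nat \<Rightarrow> complex" where
  "hc x k = pochhammer x k / fact k"

lemma hc_0 [simp]: "hc x 0 = 1" by (simp add: hc_def)

lemma hc_Suc: "of_nat (Suc k) * hc x (Suc k) = (x + of_nat k) * hc x k"
  by (simp add: hc_def pochhammer_Suc field_simps del: of_nat_Suc)

lemma hc_shift: "x * hc (x + 1) k = (x + of_nat k) * hc x k"
  using pochhammer_rec[of x k] by (simp add: hc_def pochhammer_Suc field_simps)

lemma hc_shift_Suc: "of_nat (Suc k) * hc x (Suc k) = x * hc (x + 1) k"
  unfolding hc_Suc hc_shift ..

text \<open>\<open>hc x k\<close> is the coefficient of t^k in (1 - t)^(-x); compare coefficients in
  (1 - t)^(-x-1) (1 - t) = (1 - t)^(-x).\<close>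

lemma hc_pascal: "hc (x + 1) (Suc l) = hc (x + 1) l + hc x (Suc l)"
proof -
  have "of_nat (Suc l) * hc (x + 1) (Suc l) = of_nat (Suc l) * (hc (x + 1) l + hc x (Suc l))"
    using hc_Suc[of l "x + 1"] hc_shift_Suc[of l x] by (simp add: algebra_simps)
  then show ?thesis by (simp del: of_nat_Suc)
qed

lemma hc_vandermonde: "(\<Sum>k\<le>n. hc x k * hc y (n - k)) = hc (x + y) n"
proof -
  have "hc (x + y) n = (\<Sum>k\<le>n. of_nat (n choose k) * pochhammer x k * pochhammer y (n - k)) / fact n"
    by (simp add: hc_def pochhammer_binomial_sum)
  also have "\<dots> = (\<Sum>k\<le>n. hc x k * hc y (n - k))"
    unfolding sum_divide_distrib
    by (rule sum.cong) (simp_all add: hc_def binomial_fact field_simps)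
  finally show ?thesis by simp
qed

text \<open>The coefficient of \<open>t^Q v^k u^(Q-k)\<close> in \<open>(1 - t v)^(-x) (1 - t u)^(-x-1)\<close>, i.e. the
  coefficients of Dunkl's Heisenberg polynomials. They are used with \<open>x = - c\<close>.\<close>
definition heis :: "complex \<Rightarrow> nat \<Rightarrow> nat \<Rightarrow> complex" where
  "heis x Q k = (if k \<le> Q then hc x k * hc (x + 1) (Q - k) else 0)"

text \<open>Up to a linear factor the coefficient is symmetric under exchange of \<open>k\<close>
  and \<open>Q - k\<close>, which gives the differences in \<open>heis_diff\<close>.\<close>

lemma heis_mult: "k \<le> Q \<Longrightarrow> x * heis x Q k = (x + of_nat (Q - k)) * (hc x k * hc x (Q - k))"
  unfolding heis_def using hc_shift[of x "Q - k"] by simp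

lemma heis_diff: 
  assumes "k \<le> Q"
  shows "x * (heis x Q (Q - k) - heis x Q k) = (2 * of_nat k - of_nat Q) * (hc x k * hc x (Q - k))"
  using heis_mult[of k Q x] heis_mult[of "Q - k" Q x] assms
  by (simp add: of_nat_diff algebra_simps)

lemma heis_step:
  assumes "k < Q"
  shows "of_nat (k + 1) * heis x Q (k + 1) - of_nat k * heis x Q k
    = (of_nat Q - 2 * of_nat k) * (hc x k * hc x (Q - k))"
proof -
  obtain l where l: "Q = k + Suc l" using assms less_imp_Suc_add by auto
  have 1: "of_nat (k + 1) * heis x Q (k + 1) = (x + of_nat k) * (hc x k * hc (x + 1) l)"
    using hc_Suc[of k x] by (simp add: heis_def l)
  have 2: "of_nat k * heis x Q k = of_nat k * (hc x k * hc (x + 1) (Suc l))"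
    by (simp add: heis_def l)
  have 3: "x * hc (x + 1) l = of_nat (Suc l) * hc x (Suc l)"
    by (rule hc_shift_Suc[symmetric])
  have 4: "hc (x + 1) (Suc l) = hc (x + 1) l + hc x (Suc l)" by (rule hc_pascal)
  have "of_nat (k + 1) * heis x Q (k + 1) - of_nat k * heis x Q k
     = hc x k * (x * hc (x + 1) l - of_nat k * hc x (Suc l))"
    unfolding 1 2 4 by (simp add: algebra_simps)
  also have "\<dots> = (of_nat Q - 2 * of_nat k) * (hc x k * hc x (Q - k))"
    unfolding 3 by (simp add: l algebra_simps)
  finally show ?thesis .
qed

text \<open>By \<open>heis_step\<close> and \<open>heis_diff\<close> both sides grow by the same
  amount from \<open>k\<close> to \<open>k + 1\<close>. This identity is behind the vanishing of
  \<open>Y\<close> on \<open>gv\<close>.\<close>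

lemma heis_sum:
  "k \<le> Q \<Longrightarrow> x * (\<Sum>j<k. heis x Q j - heis x Q (Q - j)) = of_nat k * heis x Q k"
proof (induction k)
  case (Suc k)
  have "x * (\<Sum>j<Suc k. heis x Q j - heis x Q (Q - j))
    = of_nat k * heis x Q k - x * (heis x Q (Q - k) - heis x Q k)"
    using Suc by (simp add: algebra_simps)
  also have "\<dots> = of_nat k * heis x Q k + (of_nat Q - 2 * of_nat k) * (hc x k * hc x (Q - k))"
    using Suc.prems by (subst heis_diff) (simp_all add: algebra_simps)
  also have "\<dots> = of_nat (Suc k) * heis x Q (Suc k)"
    using heis_step[of k Q x] Suc.prems by (simp add: diff_eq_eq add.commute)
  finally show ?case .
qed simp

lemma heis_lower:
  assumes "k \<le> Q"
  shows "of_nat (Suc Q - k) * heis x (Suc Q) k = (x + of_nat (Suc Q - k)) * heis x Q k"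
    and "of_nat (Suc k) * heis x (Suc Q) (Suc k) = (x + of_nat k) * heis x Q k"
proof -
  have "of_nat (Suc (Q - k)) * heis x (Suc Q) k = (x + 1 + of_nat (Q - k)) * heis x Q k"
    using hc_Suc[of "Q - k" "x + 1"] assms by (simp add: heis_def Suc_diff_le)
  then show "of_nat (Suc Q - k) * heis x (Suc Q) k = (x + of_nat (Suc Q - k)) * heis x Q k"
    using assms by (simp add: Suc_diff_le algebra_simps)
  show "of_nat (Suc k) * heis x (Suc Q) (Suc k) = (x + of_nat k) * heis x Q k"
    using hc_Suc[of k x] assms by (simp add: heis_def)
qed

text \<open>For the polynomials H_Q(v, u) with coefficient \<open>heis x Q k\<close> at v^k u^(Q-k)
  this reads (Q+1) H_(Q+1)(v, u) = (Q+1+x) u H_Q(v, u) + x v H_Q(u, v).\<close>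

lemma heis_rec:
  assumes "k \<le> Suc Q"
  shows "of_nat (Suc Q) * heis x (Suc Q) k = (of_nat (Suc Q) + x) * (if k \<le> Q then heis x Q k else 0)
     + x * (if k = 0 then 0 else heis x Q (Suc Q - k))"
proof (cases k)
  case 0
  then show ?thesis using heis_lower(1)[of 0 Q x] by (simp add: algebra_simps)
next
  case (Suc l)
  have r: "x * heis x Q (Q - l) = of_nat (Suc l) * (hc x (Suc l) * hc x (Q - l))"
  proof -
    have "x * heis x Q (Q - l) = hc x (Q - l) * (x * hc (x + 1) l)"
      using assms Suc by (simp add: heis_def)
    also have "\<dots> = hc x (Q - l) * (of_nat (Suc l) * hc x (Suc l))"
      unfolding hc_shift_Suc ..
    finally show ?thesis by (simp add: algebra_simps)
  qed
  have main: "of_nat (Suc Q) * hc (x + 1) (Q - l)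
    = (of_nat (Suc Q) + x) * (if Suc l \<le> Q then hc (x + 1) (Q - Suc l) else 0) + of_nat (Suc l) * hc x (Q - l)"
  proof (cases "l = Q")
    case False
    then obtain d where d: "Q = l + Suc d" using assms Suc less_imp_Suc_add[of l Q] by auto
    have "of_nat (Suc d) * hc x (Suc d) = x * hc (x + 1) d" by (rule hc_shift_Suc)
    then show ?thesis unfolding d using hc_pascal[of x d] by (simp add: algebra_simps)
  qed simp
  have "of_nat (Suc Q) * heis x (Suc Q) (Suc l) = hc x (Suc l) * (of_nat (Suc Q) * hc (x + 1) (Q - l))"
    using assms Suc by (simp add: heis_def)
  also have "\<dots> = (of_nat (Suc Q) + x) * (if Suc l \<le> Q then heis x Q (Suc l) else 0)
     + of_nat (Suc l) * (hc x (Suc l) * hc x (Q - l))"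
    unfolding main by (simp add: heis_def algebra_simps)
  finally show ?thesis unfolding r[symmetric] by (simp add: Suc)
qed

text \<open>The weight \<open>F\<close> is left arbitrary for two uses: values of the functional in
  \<open>heis_psi\<close>, and powers of \<open>w\<close> in
  \<open>heis_no_common_zero\<close>.\<close>

lemma sum_heis_rec:
  "of_nat (Suc Q) * (\<Sum>k\<le>Suc Q. heis x (Suc Q) k * F k)
    = (of_nat (Suc Q) + x) * (\<Sum>k\<le>Q. heis x Q k * F k) + x * (\<Sum>k\<le>Q. heis x Q k * F (Suc Q - k))"
proof -
  have "of_nat (Suc Q) * (\<Sum>k\<le>Suc Q. heis x (Suc Q) k * F k)
    = (\<Sum>k\<le>Suc Q. (of_nat (Suc Q) * heis x (Suc Q) k) * F k)"
    by (simp only: sum_distrib_left mult.assoc)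
  also have "\<dots> = (\<Sum>k\<le>Suc Q. (of_nat (Suc Q) + x) * ((if k \<le> Q then heis x Q k else 0) * F k)
      + x * ((if k = 0 then 0 else heis x Q (Suc Q - k)) * F k))"
    by (rule sum.cong) (simp_all only: heis_rec atMost_iff distrib_right mult.assoc)
  also have "\<dots> = (of_nat (Suc Q) + x) * (\<Sum>k\<le>Suc Q. (if k \<le> Q then heis x Q k else 0) * F k)
     + x * (\<Sum>k\<le>Suc Q. (if k = 0 then 0 else heis x Q (Suc Q - k)) * F k)"
    by (simp only: sum.distrib sum_distrib_left)
  also have "(\<Sum>k\<le>Suc Q. (if k \<le> Q then heis x Q k else 0) * F k) = (\<Sum>k\<le>Q. heis x Q k * F k)"
    by simp
  also have "(\<Sum>k\<le>Suc Q. (if k = 0 then 0 else heis x Q (Suc Q - k)) * F k) = (\<Sum>k\<le>Q. heis x Q k * F (Suc Q - k))"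
  proof -
    have "(\<Sum>k\<le>Suc Q. (if k = 0 then 0 else heis x Q (Suc Q - k)) * F k) = (\<Sum>k\<le>Q. heis x Q (Q - k) * F (Suc k))"
      unfolding sum.atMost_Suc_shift by simp
    also have "\<dots> = (\<Sum>k\<le>Q. heis x Q k * F (Suc Q - k))"
      by (intro sum.reindex_bij_witness[of _ "\<lambda>k. Q - k" "\<lambda>k. Q - k"]) (auto simp: Suc_diff_le)
    finally show ?thesis .
  qed
  finally show ?thesis .
qed

section \<open>Partial sums and sums over multiples of \<open>m\<close>\<close>

lemma sum_diff_reindex:
  fixes F :: "nat \<Rightarrow> 'a::ab_group_add"
  assumes "a \<le> N"
  shows "(\<Sum>i\<le>a. F (Suc N - i)) = (\<Sum>i\<le>Suc N. F i) - (\<Sum>i\<le>N - a. F i)"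
  using assms
proof (induction a)
  case (Suc a)
  then have "N - a = Suc (N - Suc a)" by simp
  then show ?case using Suc by (simp add: algebra_simps)
qed (simp add: algebra_simps)

lemma sum_multiples:
  fixes G :: "nat \<Rightarrow> 'a::comm_monoid_add"
  assumes "m > 0"
  shows "(\<Sum>i\<le>x. if m dvd i then G (i div m) else 0) = (\<Sum>k\<le>x div m. G k)"
proof (induction x)
  case (Suc x)
  show ?case
  proof (cases "m dvd Suc x")
    case True
    then have "Suc x div m = Suc (x div m)" by (simp add: div_Suc dvd_eq_mod_eq_0)
    then show ?thesis using True Suc by (simp only: sum.atMost_Suc if_True)
  next
    case False
    then have "Suc x div m = x div m" by (simp add: div_Suc dvd_eq_mod_eq_0)
    then show ?thesis using False Suc by (simp only: sum.atMost_Suc if_False add_0_right)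
  qed
qed simp

lemma div_diff_mult:
  fixes m n k :: nat
  assumes "m > 0" "m * k \<le> n"
  shows "(n - m * k) div m = n div m - k"
proof -
  obtain r where "n = r + m * k" using assms(2) le_Suc_ex by (metis add.commute)
  then show ?thesis using assms(1) by simp
qed

text \<open>\<open>heis_sum\<close> regrouped into the three partial sums that
  \<open>csum_gv\<close> produces.\<close>

lemma heis_sum':
  assumes "k \<le> Q"
  shows "x * ((\<Sum>j<k. heis x Q j) + (\<Sum>j\<le>Q - k. heis x Q j) - (\<Sum>j\<le>Q. heis x Q j)) = of_nat k * heis x Q k"
proof -
  have "(\<Sum>j<k. heis x Q j) + (\<Sum>j\<le>Q - k. heis x Q j) - (\<Sum>j\<le>Q. heis x Q j)
    = (\<Sum>j<k. heis x Q j - heis x Q (Q - j))"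
    using assms
  proof (induction k)
    case (Suc k)
    then have "Q - k = Suc (Q - Suc k)" by simp
    then show ?case using Suc by (simp add: algebra_simps)
  qed simp
  then show ?thesis using heis_sum[OF assms] by simp
qed

text \<open>\<open>gv m c N a\<close> and \<open>fv m c N a\<close> are the coefficients at \<open>z^a zbar^(N-a)\<close> of the polynomials
  spanning the kernels of \<open>Y\<close> and \<open>Ybar\<close> in degree \<open>N\<close>.\<close>
definition gv :: "nat \<Rightarrow> complex \<Rightarrow> nat \<Rightarrow> nat \<Rightarrow> complex" where
  "gv m c N a = (if a \<le> N \<and> m dvd a then (-1) ^ a * heis (- c) (N div m) (a div m) else 0)"

definition fv :: "nat \<Rightarrow> complex \<Rightarrow> nat \<Rightarrow> nat \<Rightarrow> complex" where
  "fv m c N a = (if a \<le> N then gv m c N (N - a) else 0)"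

text \<open>The sum common to \<open>Yc\<close> and \<open>Ybc\<close>. The residue \<open>t\<close>
  is kept apart from the bound \<open>a\<close>: it is \<open>a + 1\<close> for \<open>Yc\<close>
  and \<open>a\<close> for \<open>Ybc\<close>, and \<open>csum_mirror\<close> moves only the
  bound.\<close>

definition csum :: "nat \<Rightarrow> nat \<Rightarrow> nat \<Rightarrow> (nat \<Rightarrow> complex) \<Rightarrow> nat \<Rightarrow> complex" where
  "csum m t N p a = (\<Sum>i\<le>a. chi m i t * p i - chi m (Suc N - i) t * p (Suc N - i))"

lemma Yc_csum: "Yc m c N p a = of_nat (a + 1) * p (a + 1) + c * of_nat m * csum m (a + 1) N p a"
  by (simp add: Yc_def csum_def)

lemma Ybc_csum: "Ybc m c N p a = of_nat (Suc N - a) * p a - c * of_nat m * csum m a N p a"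
  by (simp add: Ybc_def csum_def)

lemma csum_eq:
  assumes "a \<le> N"
  shows "csum m t N p a = (\<Sum>i\<le>a. chi m i t * p i) + (\<Sum>i\<le>N - a. chi m i t * p i) - (\<Sum>i\<le>Suc N. chi m i t * p i)"
  unfolding csum_def sum_subtractf sum_diff_reindex[OF assms, of "\<lambda>i. chi m i t * p i"] by simp

lemma csum_mirror: "a \<le> N \<Longrightarrow> csum m t N p (N - a) = csum m t N p a"
  by (simp add: csum_eq)

lemma csum_cong: "a \<le> N \<Longrightarrow> (\<And>i. i \<le> Suc N \<Longrightarrow> p i = q i) \<Longrightarrow> csum m t N p a = csum m t N q a"
  by (auto simp: csum_def intro!: sum.cong)

lemma csum_gv:
  assumes m: "m > 0" and a: "a \<le> N"
  shows "csum m t N (gv m c (Suc N)) a = (if m dvd t then (-1) ^ t *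
     ((\<Sum>k\<le>a div m. heis (- c) (Suc N div m) k) + (\<Sum>k\<le>(N - a) div m. heis (- c) (Suc N div m) k)
       - (\<Sum>k\<le>Suc N div m. heis (- c) (Suc N div m) k)) else 0)"
proof -
  let ?h = "heis (- c) (Suc N div m)"
  have s: "chi m i t * gv m c (Suc N) i = (if m dvd t then (-1) ^ t * (if m dvd i then ?h (i div m) else 0) else 0)"
    if "i \<le> Suc N" for i
  proof -
    have "m dvd i \<longleftrightarrow> m dvd t" if "i mod m = t mod m" using that by (simp add: dvd_eq_mod_eq_0)
    moreover have "i mod m = t mod m" if "m dvd i" "m dvd t" using that by (simp add: dvd_eq_mod_eq_0)
    moreover have "(-1) ^ (i + t) * (-1) ^ i = ((-1) ^ t :: complex)"
      by (simp add: power_add mult_ac flip: power_mult_distrib)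
    ultimately show ?thesis using that by (auto simp: chi_def gv_def simp flip: mult.assoc)
  qed
  have S: "(\<Sum>i\<le>x. chi m i t * gv m c (Suc N) i) = (if m dvd t then (-1) ^ t * (\<Sum>k\<le>x div m. ?h k) else 0)"
    if "x \<le> Suc N" for x
  proof -
    have "(\<Sum>i\<le>x. chi m i t * gv m c (Suc N) i)
      = (\<Sum>i\<le>x. if m dvd t then (-1) ^ t * (if m dvd i then ?h (i div m) else 0) else 0)"
      using that by (intro sum.cong s) auto
    then show ?thesis using sum_multiples[OF m, of ?h x] by (simp add: sum_distrib_left[symmetric])
  qed
  show ?thesis unfolding csum_eq[OF a] using a by (subst (1 2 3) S) (simp_all add: algebra_simps)
qed

text \<open>Everything vanishes unless \<open>m\<close> divides \<open>a + 1\<close>. For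
  \<open>a + 1 = m * k\<close> the derivative and the sum cancel by
  \<open>heis_sum'\<close>.\<close>

lemma Yc_gv:
  assumes m: "m > 0" and a: "a \<le> N"
  shows "Yc m c N (gv m c (Suc N)) a = 0"
proof (cases "m dvd a + 1")
  case False
  then show ?thesis by (simp add: Yc_csum csum_gv[OF m a] gv_def)
next
  case True
  then obtain k where k: "a + 1 = m * k" by auto
  let ?Q = "Suc N div m"
  have kQ: "k \<le> ?Q" using k a m by (simp add: less_eq_div_iff_mult_less_eq mult.commute)
  have mk: "m * k \<le> Suc N" using k a by simp
  have k0: "k > 0" using k by (cases k) auto
  \<comment> \<open>As \<open>a\<close> lies just below a multiple of \<open>m\<close>, the first
    partial sum stops before \<open>k\<close>, as in \<open>heis_sum'\<close>.\<close>
  have ad: "a div m = k - 1"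
  proof -
    have "a = (k - 1) * m + (m - 1)" using k k0 m by (cases k; cases m) (auto simp: algebra_simps)
    moreover have "(m - 1) div m = 0" using m by simp
    ultimately show ?thesis using m by (metis add.right_neutral div_mult_self3 less_numeral_extra(3))
  qed
  have "N - a = Suc N - m * k" using k by simp
  then have Nd: "(N - a) div m = ?Q - k" using m k a by (simp add: div_diff_mult)
  have set: "{..k - 1} = {..<k}" using k0 by auto
  have "Yc m c N (gv m c (Suc N)) a = (-1) ^ (a + 1) * of_nat m * (of_nat k * heis (- c) ?Q k
    - (- c) * ((\<Sum>j<k. heis (- c) ?Q j) + (\<Sum>j\<le>?Q - k. heis (- c) ?Q j) - (\<Sum>j\<le>?Q. heis (- c) ?Q j)))"
    unfolding Yc_csum csum_gv[OF m a] ad Nd set using True a m mk unfolding k 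
    by (simp add: gv_def algebra_simps)
  then show ?thesis unfolding heis_sum'[OF kQ] by simp
qed

text \<open>The factor by which \<open>Ybar\<close> lowers \<open>gv\<close> from degree
  \<open>N\<close> to \<open>N - 1\<close>, see \<open>Ybc_gv\<close>. The cases reflect that the
  quotient by \<open>m\<close> drops in this passage exactly when \<open>m\<close> divides
  \<open>N\<close>.\<close>

definition dlam :: "nat \<Rightarrow> complex \<Rightarrow> nat \<Rightarrow> complex" where
  "dlam m c N = (if m dvd N then of_nat N - 2 * c * of_nat m else of_nat N - c * of_nat m)"

lemma Ybc_gv:
  assumes m: "m > 0" and a: "a \<le> N"
  shows "Ybc m c N (gv m c (Suc N)) a = dlam m c (Suc N) * gv m c N a"
proof (cases "m dvd a")
  case False
  then show ?thesis by (simp add: Ybc_csum csum_gv[OF m a] gv_def)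
next
  case True
  then obtain k where k: "a = m * k" by auto
  let ?Q = "Suc N div m" and ?h = "heis (- c) (Suc N div m)"
  have ad: "a div m = k" using k m by simp
  have kN: "k \<le> N div m" using k a m by (simp add: less_eq_div_iff_mult_less_eq mult.commute)
  have Nd: "(N - a) div m = N div m - k" using m k a by (simp add: div_diff_mult)
  have na: "of_nat (Suc N - a) = of_nat (Suc N) - of_nat m * (of_nat k :: complex)"
    using a k by (simp add: of_nat_diff Suc_diff_le)
  have Y: "Ybc m c N (gv m c (Suc N)) a = (-1) ^ a * ((of_nat (Suc N) - of_nat m * of_nat k) * ?h k
     + of_nat m * ((- c) * ((\<Sum>j\<le>k. ?h j) + (\<Sum>j\<le>N div m - k. ?h j) - (\<Sum>j\<le>?Q. ?h j))))"
    unfolding Ybc_csum csum_gv[OF m a] ad Nd na using True a ad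
    by (simp add: gv_def algebra_simps)
  show ?thesis
  proof (cases "m dvd Suc N")
    case False
    then have Q: "N div m = ?Q" by (simp add: div_Suc dvd_eq_mod_eq_0)
    \<comment> \<open>The Heisenberg degree is unchanged here: the term \<open>j = k\<close> is
      split off and \<open>heis_sum'\<close> evaluates the rest.\<close>
    have "(- c) * ((\<Sum>j\<le>k. ?h j) + (\<Sum>j\<le>?Q - k. ?h j) - (\<Sum>j\<le>?Q. ?h j))
      = (- c) * ?h k + (- c) * ((\<Sum>j<k. ?h j) + (\<Sum>j\<le>?Q - k. ?h j) - (\<Sum>j\<le>?Q. ?h j))"
      by (simp add: algebra_simps flip: lessThan_Suc_atMost)
    also have "\<dots> = (of_nat k - c) * ?h k"
      using kN Q by (subst heis_sum') (simp_all add: algebra_simps)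
    finally have 1: "(- c) * ((\<Sum>j\<le>k. ?h j) + (\<Sum>j\<le>?Q - k. ?h j) - (\<Sum>j\<le>?Q. ?h j)) = (of_nat k - c) * ?h k" .
    show ?thesis unfolding Y Q 1 using False True a Q ad
      by (simp add: dlam_def gv_def algebra_simps)
  next
    \<comment> \<open>The Heisenberg degree drops by one, so the two parts of
      \<open>heis_lower\<close> convert both terms to degree \<open>N div m\<close>; the dependence
      of the factor on \<open>k\<close> then cancels.\<close>
    case mdvd: True
    then have Q: "?Q = Suc (N div m)" by (simp add: div_Suc dvd_eq_mod_eq_0)
    have SN: "of_nat (Suc N) = of_nat m * (of_nat ?Q :: complex)" using mdvd
      by (metis dvd_mult_div_cancel of_nat_mult)
    have "(- c) * ((\<Sum>j\<le>k. ?h j) + (\<Sum>j\<le>N div m - k. ?h j) - (\<Sum>j\<le>?Q. ?h j))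
       = (- c) * ((\<Sum>j<Suc k. ?h j) + (\<Sum>j\<le>?Q - Suc k. ?h j) - (\<Sum>j\<le>?Q. ?h j))"
      by (simp add: Q lessThan_Suc_atMost)
    also have "\<dots> = of_nat (Suc k) * ?h (Suc k)"
      using kN by (subst heis_sum') (simp_all add: Q)
    also have "\<dots> = (- c + of_nat k) * heis (- c) (N div m) k"
      unfolding Q using kN by (rule heis_lower(2))
    finally have 1: "(- c) * ((\<Sum>j\<le>k. ?h j) + (\<Sum>j\<le>N div m - k. ?h j) - (\<Sum>j\<le>?Q. ?h j)) = (- c + of_nat k) * heis (- c) (N div m) k" .
    have 2: "(of_nat ?Q - of_nat k) * ?h k = (- c + (of_nat ?Q - of_nat k)) * heis (- c) (N div m) k"
      using heis_lower(1)[OF kN, of "- c"] kN unfolding Q by (simp add: of_nat_diff Suc_diff_le algebra_simps)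
    have "Ybc m c N (gv m c (Suc N)) a = (-1) ^ a * of_nat m * ((of_nat ?Q - of_nat k) * ?h k
       + (- c + of_nat k) * heis (- c) (N div m) k)"
      unfolding Y 1 SN by (simp add: algebra_simps)
    also have "\<dots> = dlam m c (Suc N) * gv m c N a"
      unfolding 2 using mdvd True a ad SN by (simp add: dlam_def gv_def algebra_simps)
    finally show ?thesis .
  qed
qed

section \<open>The symmetry exchanging z and zbar\<close>

lemma chi_mirror:
  assumes "i \<le> Suc N" "a \<le> N"
  shows "chi m (Suc N - i) (a + 1) = chi m i (N - a)"
proof -
  \<comment> \<open>Adding even numbers to both sides avoids truncated subtraction and shows equal
    parity.\<close>
  have e: "Suc N - i + (a + 1) + 2 * i = i + (N - a) + 2 * (a + 1)" using assms by simp
  have "even (Suc N - i + (a + 1)) = even (i + (N - a))"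
    using arg_cong[OF e, of even] by (simp del: add_diff_assoc add_Suc_right)
  then have sgn: "(-1 :: complex) ^ (Suc N - i + (a + 1)) = (-1) ^ (i + (N - a))"
    by (simp only: minus_one_power_iff)
  have "int (Suc N - i) mod int m = int (a + 1) mod int m \<longleftrightarrow> int i mod int m = int (N - a) mod int m"
  proof -
    have "int (Suc N - i) - int (a + 1) = - (int i - int (N - a))" using assms by (simp add: of_nat_diff)
    then show ?thesis unfolding mod_eq_dvd_iff by (simp only: dvd_minus_iff)
  qed
  then have "(Suc N - i) mod m = (a + 1) mod m \<longleftrightarrow> i mod m = (N - a) mod m"
    by (simp only: zmod_int[symmetric] of_nat_eq_iff)
  then show ?thesis unfolding chi_def sgn by simp
qed

text \<open>Exchanging z and zbar exchanges \<open>Y\<close> and \<open>Ybar\<close>; this transfers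
  results on \<open>gv\<close> and \<open>Y\<close> to \<open>fv\<close> and \<open>Ybar\<close>,
  and back.\<close>

lemma Yc_mirror:
  assumes a: "a \<le> N"
  shows "Yc m c N p a = Ybc m c N (\<lambda>i. p (Suc N - i)) (N - a)"
proof -
  have "csum m (N - a) N (\<lambda>i. p (Suc N - i)) (N - a) = csum m (N - a) N (\<lambda>i. p (Suc N - i)) a"
    by (rule csum_mirror[OF a])
  also have "\<dots> = - csum m (a + 1) N p a"
    unfolding csum_def sum_negf[symmetric]
  proof (rule sum.cong)
    fix i assume "i \<in> {..a}"
    then have i: "i \<le> Suc N" using a by simp
    show "chi m i (N - a) * p (Suc N - i) - chi m (Suc N - i) (N - a) * p (Suc N - (Suc N - i))
      = - (chi m i (a + 1) * p i - chi m (Suc N - i) (a + 1) * p (Suc N - i))"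
      using chi_mirror[OF i a, of m] chi_mirror[of "Suc N - i" N a m] i a by simp
  qed simp
  finally show ?thesis using a by (simp add: Yc_csum Ybc_csum Suc_diff_le)
qed

lemma Yc_cong: "a \<le> N \<Longrightarrow> (\<And>i. i \<le> Suc N \<Longrightarrow> p i = q i) \<Longrightarrow> Yc m c N p a = Yc m c N q a"
  unfolding Yc_csum using csum_cong[of a N p q m "a + 1"] by simp

lemma Ybc_cong: "a \<le> N \<Longrightarrow> (\<And>i. i \<le> Suc N \<Longrightarrow> p i = q i) \<Longrightarrow> Ybc m c N p a = Ybc m c N q a"
  unfolding Ybc_csum using csum_cong[of a N p q m a] by simp

lemma Ybc_mirror:
  assumes a: "a \<le> N"
  shows "Ybc m c N p a = Yc m c N (\<lambda>i. p (Suc N - i)) (N - a)"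
  using a by (simp add: Yc_mirror) (rule Ybc_cong, auto)

lemma Ybc_fv:
  assumes "m > 0" "a \<le> N"
  shows "Ybc m c N (fv m c (Suc N)) a = 0"
proof -
  have "Yc m c N (\<lambda>i. fv m c (Suc N) (Suc N - i)) (N - a) = Yc m c N (gv m c (Suc N)) (N - a)"
    by (rule Yc_cong) (auto simp: fv_def)
  then show ?thesis using assms by (simp add: Ybc_mirror Yc_gv)
qed

lemma csum_lincomb: "csum m t N (\<lambda>i. s * p i + r * q i) a = s * csum m t N p a + r * csum m t N q a"
  unfolding csum_def by (simp add: sum.distrib sum_distrib_left sum_subtractf algebra_simps)

lemma Ybc_lincomb: "Ybc m c N (\<lambda>i. s * p i + r * q i) a = s * Ybc m c N p a + r * Ybc m c N q a"
  unfolding Ybc_csum csum_lincomb by (simp add: algebra_simps)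

section \<open>The kernels are lines; consequences of regularity\<close>

lemma csum_0: "(\<And>i. i \<le> a \<Longrightarrow> p i = 0 \<and> p (Suc N - i) = 0) \<Longrightarrow> csum m t N p a = 0"
  by (simp add: csum_def)

text \<open>The coefficients are eliminated from both ends towards the middle: the equation at \<open>M\<close> gives
  \<open>p M = 0\<close>, then the one at \<open>N - M\<close> gives \<open>p (N - M) = 0\<close>, because by \<open>csum_mirror\<close> only outer coefficients
  occur in it.\<close>
lemma Ybc_kernel_zero:
  assumes Y: "\<And>a. a \<le> N \<Longrightarrow> Ybc m c N p a = 0"
    and top: "p (Suc N) = 0" and bot: "p 0 = 0 \<or> c * of_nat m \<noteq> of_nat (Suc N)"
    and c: "\<And>j. 1 \<le> j \<Longrightarrow> j \<le> N \<Longrightarrow> c * of_nat m \<noteq> of_nat j"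
    and a: "a \<le> Suc N"
  shows "p a = 0"
proof -
  have "M \<le> Suc N \<Longrightarrow> (\<forall>i<M. p i = 0) \<and> (\<forall>i\<le>M. i \<le> Suc N \<longrightarrow> p (Suc N - i) = 0)" for M
  proof (induction M)
    case 0
    then show ?case using top by simp
  next
    case (Suc M)
    then have M: "M \<le> N" and lo: "\<And>i. i < M \<Longrightarrow> p i = 0" and hi: "\<And>i. i \<le> M \<Longrightarrow> p (Suc N - i) = 0"
      by auto
    have "csum m M N p M = p M"
    proof (cases M)
      case 0
      then show ?thesis using top by (simp add: csum_def chi_def)
    next
      case (Suc K)
      have "csum m M N p K = 0" by (rule csum_0) (use lo hi Suc in auto)
      then show ?thesis using hi[of M] unfolding csum_def Suc by (simp add: chi_def)
    qed
    then have "(of_nat (Suc N - M) - c * of_nat m) * p M = 0"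
      using Y[OF M] by (simp add: Ybc_csum algebra_simps)
    \<comment> \<open>For \<open>M = 0\<close> the value to avoid is \<open>Suc N\<close>, outside
      the range of the assumption \<open>c\<close>; there \<open>bot\<close> is used.\<close>
    moreover have "c * of_nat m \<noteq> of_nat (Suc N - M)" if "p M \<noteq> 0"
      using c[of "Suc N - M"] bot that M by (cases "M = 0") auto
    ultimately have pM: "p M = 0" by fastforce
    then have lo': "\<And>i. i < Suc M \<Longrightarrow> p i = 0" using lo less_Suc_eq by auto
    have "csum m (N - M) N p (N - M) = 0"
      unfolding csum_mirror[OF M] by (rule csum_0) (use lo' hi in auto)
    then have "of_nat (Suc N - (N - M)) * p (N - M) = 0"
      using Y[of "N - M"] unfolding Ybc_csum by simp
    then have "p (Suc N - Suc M) = 0" using M by (simp add: Suc_diff_le del: of_nat_Suc)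
    then show ?case using lo' hi le_Suc_eq by auto
  qed
  from this[of "Suc N"] show ?thesis using a top less_Suc_eq_le by (metis order.refl le_neq_implies_less)
qed

lemma hc_nonzero_iff: "hc x k \<noteq> 0 \<longleftrightarrow> (\<forall>i<k. x \<noteq> - of_nat i)"
  by (simp add: hc_def pochhammer_eq_0_iff)

lemma gv_bot: "gv m c N 0 = hc (1 - c) (N div m)"
  by (simp add: gv_def heis_def)

lemma gv_top: "m > 0 \<Longrightarrow> m dvd N \<Longrightarrow> gv m c N N = (-1) ^ N * hc (- c) (N div m)"
  by (auto simp: gv_def heis_def)

text \<open>Subtracting the multiple of \<open>fv\<close> that matches one end coefficient leaves a
  sequence for \<open>Ybc_kernel_zero\<close>. The end is z^(N+1), except when c m = N + 1: then
  kernel elements have no such term, and the end zbar^(N+1) is matched.\<close>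

lemma Ybc_kernel_span:
  assumes m: "m > 0"
    and Y: "\<And>a. a \<le> N \<Longrightarrow> Ybc m c N p a = 0"
    and SN: "m dvd Suc N \<or> c * of_nat m \<noteq> of_nat (Suc N)"
    and c: "\<And>j. 1 \<le> j \<Longrightarrow> j \<le> N \<Longrightarrow> c * of_nat m \<noteq> of_nat j"
  shows "\<exists>t. \<forall>a\<le>Suc N. p a = t * fv m c (Suc N) a"
proof -
  let ?f = "fv m c (Suc N)"
  have d: "Ybc m c N (\<lambda>i. 1 * p i + (- t) * ?f i) a = 0" if "a \<le> N" for a t
    unfolding Ybc_lincomb using Y[OF that] Ybc_fv[OF m that] by simp
  show ?thesis
  proof (cases "c * of_nat m = of_nat (Suc N)")
    case False
    have "1 - c \<noteq> - of_nat i" if i: "i < Suc N div m" for i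
    proof
      assume "1 - c = - of_nat i"
      then have "c = of_nat (Suc i)" by (simp add: algebra_simps)
      then have "c * of_nat m = of_nat (Suc i * m)" by (simp only: of_nat_mult)
      moreover have "Suc i * m \<le> Suc N" using i m by (metis Suc_leI less_eq_div_iff_mult_less_eq)
      moreover have "1 \<le> Suc i * m" using m by simp
      ultimately show False using c[of "Suc i * m"] False by (metis le_SucE)
    qed
    then have "?f (Suc N) \<noteq> 0" by (simp add: fv_def gv_bot hc_nonzero_iff)
    define t where "t = p (Suc N) / ?f (Suc N)"
    have "1 * p a + (- t) * ?f a = 0" if "a \<le> Suc N" for a
      by (rule Ybc_kernel_zero[where p = "\<lambda>a. 1 * p a + (- t) * ?f a", OF d _ _ c that])
        (use False \<open>?f (Suc N) \<noteq> 0\<close> in \<open>auto simp: t_def\<close>)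
    then show ?thesis by (auto intro!: exI[of _ t])
  next
    case True
    with SN have dv: "m dvd Suc N" by simp
    have "p' (Suc N) = 0" if "\<And>a. a \<le> N \<Longrightarrow> Ybc m c N p' a = 0" for p'
    proof -
      have "chi m (Suc N) 0 \<noteq> 0" using dv by (simp add: chi_def)
      moreover have "c * of_nat m \<noteq> 0" unfolding True by (simp del: of_nat_Suc)
      \<comment> \<open>In the equation at \<open>a = 0\<close> the terms with \<open>p' 0\<close>
        cancel because c m = N + 1, and only the top coefficient is left.\<close>
      moreover have "c * of_nat m * (chi m (Suc N) 0 * p' (Suc N)) = 0"
        using that[of 0] unfolding Ybc_csum True by (simp add: csum_def chi_def algebra_simps)
      ultimately show ?thesis by simp
    qed
    note top = this
    have cQ: "c = of_nat (Suc N div m)"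
      using True dv m by (metis dvd_div_mult_self mult_right_cancel of_nat_eq_0_iff of_nat_mult not_gr_zero)
    have "?f 0 \<noteq> 0" using gv_top[OF m dv] by (simp add: fv_def hc_nonzero_iff cQ)
    define t where "t = p 0 / ?f 0"
    have "1 * p a + (- t) * ?f a = 0" if "a \<le> Suc N" for a
      by (rule Ybc_kernel_zero[where p = "\<lambda>a. 1 * p a + (- t) * ?f a", OF d _ _ c that])
        (use top[OF Y] top[OF Ybc_fv[OF m]] \<open>?f 0 \<noteq> 0\<close> in \<open>auto simp: t_def\<close>)
    then show ?thesis by (auto intro!: exI[of _ t])
  qed
qed

lemma Yc_kernel_span:
  assumes m: "m > 0"
    and Y: "\<And>a. a \<le> N \<Longrightarrow> Yc m c N p a = 0"
    and SN: "m dvd Suc N \<or> c * of_nat m \<noteq> of_nat (Suc N)"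
    and c: "\<And>j. 1 \<le> j \<Longrightarrow> j \<le> N \<Longrightarrow> c * of_nat m \<noteq> of_nat j"
  shows "\<exists>t. \<forall>a\<le>Suc N. p a = t * gv m c (Suc N) a"
proof -
  have "Ybc m c N (\<lambda>i. p (Suc N - i)) a = 0" if "a \<le> N" for a
    using Y[of "N - a"] Yc_mirror[of "N - a" N m c p] that by simp
  from Ybc_kernel_span[OF m this SN c] obtain t
    where t: "\<forall>a\<le>Suc N. p (Suc N - a) = t * fv m c (Suc N) a" by auto
  have "p a = t * gv m c (Suc N) a" if "a \<le> Suc N" for a
    using t[rule_format, of "Suc N - a"] that by (simp add: fv_def)
  then show ?thesis by blast
qed

text \<open>When \<open>dlam\<close> vanishes, both operators kill the polynomial of
  \<open>gv\<close>, so regularity makes it zero. Its coefficient at z^0 is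
  \<open>hc (1 - c) (Suc N div m)\<close>, which vanishes only for the listed integers. All uses of
  regularity pass through this lemma.\<close>

lemma regular_singular_degree:
  assumes m: "m > 0" and reg: "regular_const m c" and d: "dlam m c (Suc N) = 0"
  shows "\<exists>i<Suc N div m. c = of_nat (Suc i)"
proof (rule ccontr)
  assume *: "\<not> ?thesis"
  have "1 - c \<noteq> - of_nat i" if "i < Suc N div m" for i
  proof
    assume "1 - c = - of_nat i"
    then have "c = of_nat (Suc i)" by (simp add: algebra_simps)
    then show False using * that by blast
  qed
  then have "gv m c (Suc N) 0 \<noteq> 0" by (simp add: gv_bot hc_nonzero_iff)
  then have "hom (Suc N) (gv m c (Suc N)) \<noteq> 0" unfolding hom_eq_0_iff by blast
  moreover have "DunklY m c (hom (Suc N) (gv m c (Suc N))) = 0"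
    unfolding DunklY_hom[OF m] hom_eq_0_iff using Yc_gv[OF m] by simp
  moreover have "DunklYb m c (hom (Suc N) (gv m c (Suc N))) = 0"
    unfolding DunklYb_hom[OF m] hom_eq_0_iff using Ybc_gv[OF m] d by simp
  ultimately show False using reg homog_hom[of "Suc N"] unfolding regular_const_def by blast
qed

text \<open>In degree \<open>j\<close> the factor \<open>dlam\<close> is j - c m; its vanishing
  would make \<open>c\<close> an integer and \<open>j\<close> a multiple of
  \<open>m\<close>.\<close>

lemma regular_not_multiple:
  assumes m: "m > 0" and reg: "regular_const m c" and j: "\<not> m dvd j"
  shows "c * of_nat m \<noteq> of_nat j"
proof
  assume eq: "c * of_nat m = of_nat j"
  obtain N where N: "j = Suc N" using j by (cases j) auto
  have "dlam m c (Suc N) = 0" using j eq by (simp add: dlam_def N)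
  then obtain i where "c = of_nat (Suc i)" using regular_singular_degree[OF m reg] by blast
  then have "(of_nat (Suc i * m) :: complex) = of_nat j" unfolding eq[symmetric] by (simp only: of_nat_mult)
  then show False using j by (metis dvd_triv_right of_nat_eq_iff)
qed

text \<open>In degree \<open>m * Q\<close> the factor \<open>dlam\<close> is m (Q - 2 c); its
  vanishing would make \<open>c\<close> an integer and \<open>Q\<close> even.\<close>

lemma regular_not_half:
  assumes m: "m > 0" and reg: "regular_const m c" and Q: "odd Q"
  shows "2 * c \<noteq> of_nat Q"
proof
  assume eq: "2 * c = of_nat Q"
  obtain N where N: "m * Q = Suc N" using m Q by (cases "m * Q") auto
  have "dlam m c (Suc N) = 0" unfolding N[symmetric] using arg_cong[OF eq, of "\<lambda>x. x * of_nat m"] by (auto simp: dlam_def algebra_simps)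
  then obtain i where "c = of_nat (Suc i)" using regular_singular_degree[OF m reg] by blast
  then have "(of_nat (2 * Suc i) :: complex) = of_nat Q" unfolding eq[symmetric] by (simp only: of_nat_mult of_nat_numeral)
  then show False using Q by (metis dvd_triv_left of_nat_eq_iff)
qed

lemma fv_in_QH:
  assumes m: "m > 0"
  shows "hom (Suc n) (fv m c (Suc n)) \<in> QH m c (Suc n)"
proof -
  have "hom n (Ybc m c n (fv m c (Suc n))) = 0" unfolding hom_eq_0_iff using Ybc_fv[OF m] by simp
  moreover have "DunklY m c 0 = 0" using DunklY_hom_0[of m c "\<lambda>_. 0"] by simp
  ultimately show ?thesis by (simp add: QH_def homog_hom DunklF_def DunklYb_hom[OF m])
qed

lemma gv_in_QH:
  assumes m: "m > 0"
  shows "hom (Suc n) (gv m c (Suc n)) \<in> QH m c (Suc n)"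
proof -
  have Yb: "hom n (Ybc m c n (gv m c (Suc n))) = hom n (\<lambda>a. dlam m c (Suc n) * gv m c n a)"
    by (rule hom_cong) (rule Ybc_gv[OF m])
  have "DunklY m c (hom n (\<lambda>a. dlam m c (Suc n) * gv m c n a)) = 0"
  proof (cases n)
    case 0
    then show ?thesis by (simp only: DunklY_hom_0)
  next
    case (Suc N)
    have "Yc m c N (\<lambda>a. d * gv m c (Suc N) a) a = d * Yc m c N (gv m c (Suc N)) a" for d a
      by (simp add: Yc_def algebra_simps sum_distrib_left)
    then show ?thesis using Yc_gv[OF m] by (simp only: Suc DunklY_hom[OF m] hom_eq_0_iff) simp
  qed
  then show ?thesis by (simp add: QH_def homog_hom DunklF_def DunklYb_hom[OF m] Yb)
qed

section \<open>The functional on the quasi-harmonic polynomials\<close>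

lemma phi_hom: "phi m c n (hom (2 * n) p) = (\<Sum>a\<le>2 * n. p a * phi_mono m c n a)"
  unfolding phi_def by (rule sum.cong) (simp_all add: cf2_hom)

lemma phi_sum: "phi m c n (\<Sum>i\<in>I. P i) = (\<Sum>i\<in>I. phi m c n (P i))"
  unfolding phi_def by (subst sum.swap) (simp add: sum_distrib_right)

lemma phi_monom_mult_hom:
  "phi m c n (monom (monom x j) i * hom (Suc n) p) =
    (if i + j + Suc n = 2 * n then x * (\<Sum>k\<le>Suc n. p k * phi_mono m c n (i + k)) else 0)"
proof (cases "i + j + Suc n = 2 * n")
  case False
  have "cf2 (monom (monom x j) i * hom (Suc n) p) a (2 * n - a) = 0" if "a \<le> 2 * n" for a
    using False that by (auto simp: cf2_monom2_mult cf2_hom)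
  then show ?thesis using False by (simp add: phi_def)
next
  case True
  have e: "cf2 (monom (monom x j) i * hom (Suc n) p) a (2 * n - a)
    = (if a \<in> {i..i + Suc n} then x * p (a - i) else 0)" if "a \<le> 2 * n" for a
    using True that by (auto simp: cf2_monom2_mult cf2_hom)
  have "phi m c n (monom (monom x j) i * hom (Suc n) p)
    = (\<Sum>a\<le>2 * n. if a \<in> {i..i + Suc n} then x * p (a - i) * phi_mono m c n a else 0)"
    unfolding phi_def by (rule sum.cong) (simp_all add: e)
  also have "\<dots> = (\<Sum>a\<in>{i..i + Suc n}. x * p (a - i) * phi_mono m c n a)"
    using True by (intro sum.mono_neutral_cong_right) auto
  also have "\<dots> = (\<Sum>k\<le>Suc n. x * p k * phi_mono m c n (i + k))"
    by (rule sum.reindex_bij_witness[of _ "\<lambda>k. i + k" "\<lambda>a. a - i"]) auto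
  finally show ?thesis using True by (simp only: if_True sum_distrib_left mult.assoc simp_thms)
qed

lemma bipoly_as_monoms: "G = (\<Sum>i\<le>degree G. \<Sum>j\<le>degree (coeff G i). monom (monom (cf2 G i j) j) i)"
proof -
  have "monom (coeff G i) i = (\<Sum>j\<le>degree (coeff G i). monom (monom (cf2 G i j) j) i)" for i
    by (subst (1) poly_as_sum_of_monoms[symmetric, of "coeff G i"]) (simp add: monom_sum cf2_def)
  then show ?thesis by (metis (no_types, lifting) poly_as_sum_of_monoms sum.cong)
qed

text \<open>Only monomial multipliers of degree \<open>n - 1\<close> need testing: with any other
  the product misses degree \<open>2 * n\<close>, which is all that \<open>phi\<close> sees.\<close>

lemma phi_mult_hom_zero:
  assumes "\<And>i j. i + j + Suc n = 2 * n \<Longrightarrow> (\<Sum>k\<le>Suc n. p k * phi_mono m c n (i + k)) = 0"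
  shows "phi m c n (G * hom (Suc n) p) = 0"
proof -
  have "G * hom (Suc n) p = (\<Sum>i\<le>degree G. \<Sum>j\<le>degree (coeff G i). monom (monom (cf2 G i j) j) i * hom (Suc n) p)"
    by (subst bipoly_as_monoms) (simp add: sum_distrib_right)
  moreover have "phi m c n (monom (monom x j) i * hom (Suc n) p) = 0" for x i j
    unfolding phi_monom_mult_hom using assms by simp
  ultimately show ?thesis by (simp add: phi_sum)
qed

section \<open>Values of the functional against Heisenberg coefficients\<close>

definition ndist :: "nat \<Rightarrow> nat \<Rightarrow> nat" where "ndist k l = (k - l) + (l - k)"

text \<open>The sign of \<open>phi_val\<close> is split off because in \<open>phi_gv\<close> it
  combines with the sign of \<open>gv\<close> to a constant.\<close>

definition psi :: "complex \<Rightarrow> nat \<Rightarrow> complex" where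
  "psi c k = pochhammer c k / (\<Prod>i=1..k. (of_nat i - c))"

text \<open>The denominator of \<open>psi\<close> is \<open>pochhammer (1 - c) k\<close>, the
  numerator of \<open>hc (1 - c) k\<close>.\<close>

lemma psi_hc:
  assumes "\<And>i. 1 \<le> i \<Longrightarrow> i \<le> k \<Longrightarrow> c \<noteq> of_nat i"
  shows "hc (1 - c) k * psi c k = hc c k"
proof -
  have "(\<Prod>i=1..k. (of_nat i - c)) = pochhammer (1 - c) k"
    by (induction k) (simp_all add: pochhammer_Suc algebra_simps)
  moreover have "(\<Prod>i=1..k. (of_nat i - c)) \<noteq> 0" using assms by (auto simp: prod_zero_iff Ball_def[symmetric]) force
  ultimately show ?thesis by (simp add: hc_def psi_def)
qed

text \<open>Induction through \<open>sum_heis_rec\<close>: below the boundary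
  \<open>l = Suc Q\<close> the two sums are the case \<open>Q\<close> at \<open>l\<close> and at
  \<open>Suc Q - l\<close>. On the boundary the denominators cancel by \<open>psi_hc\<close>, and
  Vandermonde gives \<open>hc 0 (Suc Q) = 0\<close>. The last premise excludes
  \<open>l = Q = Suc q\<close>, where distance \<open>Suc q\<close> occurs although
  \<open>c = of_nat (Suc q)\<close> is possible.\<close>

lemma heis_psi:
  assumes c: "\<And>i. 1 \<le> i \<Longrightarrow> i \<le> q \<Longrightarrow> c \<noteq> of_nat i"
  shows "Q \<le> Suc q \<Longrightarrow> 1 \<le> l \<Longrightarrow> l \<le> Q \<Longrightarrow> l < Q \<or> Q \<le> q
    \<Longrightarrow> (\<Sum>k\<le>Q. heis (- c) Q k * psi c (ndist k l)) = 0"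
proof (induction Q arbitrary: l)
  case (Suc Q)
  show ?case
  proof (cases "l = Suc Q")
    case True
    have "(\<Sum>k\<le>Suc Q. heis (- c) (Suc Q) k * psi c (ndist k l)) = (\<Sum>k\<le>Suc Q. hc (- c) k * hc c (Suc Q - k))"
    proof (rule sum.cong)
      fix k assume "k \<in> {..Suc Q}"
      then have "hc (1 - c) (Suc Q - k) * psi c (Suc Q - k) = hc c (Suc Q - k)"
        using True Suc.prems by (intro psi_hc c) auto
      then show "heis (- c) (Suc Q) k * psi c (ndist k l) = hc (- c) k * hc c (Suc Q - k)"
        using True \<open>k \<in> _\<close> by (simp add: heis_def ndist_def)
    qed simp
    also have "\<dots> = 0" unfolding hc_vandermonde by (simp add: hc_def pochhammer_rec)
    finally show ?thesis .
  next
    case False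
    let ?x = "- c" and ?h = "heis (- c) Q"
    have 1: "(\<Sum>k\<le>Q. ?h k * psi c (ndist k l)) = 0"
      using Suc.prems False by (intro Suc.IH) auto
    have 2: "(\<Sum>k\<le>Q. ?h k * psi c (ndist k (Suc Q - l))) = 0"
      using Suc.prems False by (intro Suc.IH) auto
    have "(\<Sum>k\<le>Q. ?h k * psi c (ndist (Suc Q - k) l)) = (\<Sum>k\<le>Q. ?h k * psi c (ndist k (Suc Q - l)))"
      using Suc.prems by (intro sum.cong) (auto simp: ndist_def add.commute)
    then have "of_nat (Suc Q) * (\<Sum>k\<le>Suc Q. heis ?x (Suc Q) k * psi c (ndist k l)) = 0"
      unfolding sum_heis_rec[of Q ?x "\<lambda>k. psi c (ndist k l)"] 1 by (simp only: 2 mult_zero_right add_0)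
    then show ?thesis by (simp del: of_nat_Suc)
  qed
qed simp

lemma phi_val_psi: "phi_val m c k = (-1) ^ (m * k) * psi c k"
  by (simp add: phi_val_def psi_def)

lemma phi_mono_eq:
  assumes m: "m > 0" and a: "a = n + m * k \<or> a + m * k = n" and k: "k \<le> n div m"
  shows "phi_mono m c n a = phi_val m c k"
proof (cases "k = 0")
  case True
  then show ?thesis using a by (auto simp: phi_mono_def phi_val_def)
next
  case False
  then have "a \<noteq> n" using a m by auto
  have "(THE k. 1 \<le> k \<and> k \<le> n div m \<and> (a = n + m * k \<or> a + m * k = n)) = k"
  proof (rule the_equality)
    show "1 \<le> k \<and> k \<le> n div m \<and> (a = n + m * k \<or> a + m * k = n)" using False a k by simp
    fix k' assume "1 \<le> k' \<and> k' \<le> n div m \<and> (a = n + m * k' \<or> a + m * k' = n)"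
    then have "m * k' = m * k" using a \<open>a \<noteq> n\<close> by auto
    then show "k' = k" using m by simp
  qed
  moreover have "\<exists>k. 1 \<le> k \<and> k \<le> n div m \<and> (a = n + m * k \<or> a + m * k = n)"
    using False a k by (intro exI[of _ k]) simp
  ultimately show ?thesis using \<open>a \<noteq> n\<close> by (simp add: phi_mono_def)
qed

lemma phi_mono_0: "a mod m \<noteq> n mod m \<Longrightarrow> phi_mono m c n a = 0"
  by (auto simp: phi_mono_def)

lemma phi_mono_mirror:
  assumes "a \<le> 2 * n"
  shows "phi_mono m c n (2 * n - a) = phi_mono m c n a"
proof -
  have "(2 * n - a = n + m * k \<or> 2 * n - a + m * k = n) \<longleftrightarrow> (a = n + m * k \<or> a + m * k = n)" for k
    using assms by auto
  moreover have "2 * n - a = n \<longleftrightarrow> a = n" using assms by auto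
  ultimately show ?thesis by (simp only: phi_mono_def)
qed

text \<open>Nonzero products need \<open>m\<close> to divide \<open>k\<close> and
  \<open>i + k\<close> to be congruent to \<open>n\<close>, hence n = i + m l. The term k = m k'
  then lies at distance \<open>m * ndist k' l\<close> from the middle monomial, and
  \<open>heis_psi\<close> applies at \<open>l\<close>.\<close>

lemma phi_gv:
  assumes m: "m > 0" and c: "\<And>k. 1 \<le> k \<Longrightarrow> k \<le> n div m \<Longrightarrow> c \<noteq> of_nat k"
    and ij: "i + j + Suc n = 2 * n"
  shows "(\<Sum>k\<le>Suc n. gv m c (Suc n) k * phi_mono m c n (i + k)) = 0"
proof (cases "m dvd n - i")
  case False
  have "gv m c (Suc n) k * phi_mono m c n (i + k) = 0" for k
  proof (cases "m dvd k")
    case True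
    then have "(i + k) mod m = i mod m" by auto
    moreover have "i mod m \<noteq> n mod m"
    proof
      assume "i mod m = n mod m"
      moreover have "i \<le> n" using ij by simp
      ultimately show False using False mod_eq_dvd_iff_nat[of i n m] by simp
    qed
    ultimately show ?thesis using phi_mono_0 by simp
  qed (simp add: gv_def)
  then show ?thesis by (intro sum.neutral) blast
next
  case True
  then obtain l where l: "n - i = m * l" by (rule dvdE)
  have i: "n = i + m * l" using l ij by simp
  have l1: "1 \<le> l" using i ij by (cases l) auto
  have lq: "l \<le> n div m" using i m by (simp add: less_eq_div_iff_mult_less_eq mult.commute)
  let ?Q = "Suc n div m"
  have Q: "?Q = (if m dvd Suc n then Suc (n div m) else n div m)" by (simp add: div_Suc dvd_eq_mod_eq_0)
  let ?G = "\<lambda>k. (-1) ^ (m * l) * (heis (- c) ?Q k * psi c (ndist k l))"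
  have "gv m c (Suc n) k * phi_mono m c n (i + k) = (if m dvd k then ?G (k div m) else 0)" if "k \<le> Suc n" for k
  proof (cases "m dvd k")
    case False
    then show ?thesis by (simp add: gv_def)
  next
    case True
    then obtain k' where k': "k = m * k'" by auto
    have 1: "i + k = n + m * ndist k' l \<or> i + k + m * ndist k' l = n"
    proof (cases "k' \<le> l")
      case True
      then have "m * k' + m * (l - k') = m * l" by (simp flip: distrib_left)
      then show ?thesis using True by (simp add: ndist_def i k')
    next
      case False
      then have "m * l + m * (k' - l) = m * k'" by (simp flip: distrib_left)
      then show ?thesis using False by (simp add: ndist_def i k')
    qed
    \<comment> \<open>As \<open>i + k \<le> 2 * n\<close>, the distance stays in the range where
      \<open>phi_mono\<close> is given by \<open>phi_val\<close>.\<close>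
    then have "m * ndist k' l \<le> n" using that ij by auto
    then have 2: "ndist k' l \<le> n div m" using m by (simp add: less_eq_div_iff_mult_less_eq mult.commute)
    have "even (m * k' + m * ndist k' l) = even (m * l)" by (auto simp: ndist_def)
    then have 3: "(-1 :: complex) ^ (m * k') * (-1) ^ (m * ndist k' l) = (-1) ^ (m * l)"
      unfolding power_add[symmetric] by (simp only: minus_one_power_iff)
    have "gv m c (Suc n) k * phi_mono m c n (i + k)
      = ((-1) ^ (m * k') * (-1) ^ (m * ndist k' l)) * (heis (- c) ?Q k' * psi c (ndist k' l))"
      unfolding phi_mono_eq[OF m 1 2] phi_val_psi using that m by (simp add: gv_def k')
    then show ?thesis unfolding 3 using m by (simp add: k')
  qed
  then have "(\<Sum>k\<le>Suc n. gv m c (Suc n) k * phi_mono m c n (i + k))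
    = (\<Sum>k\<le>Suc n. if m dvd k then ?G (k div m) else 0)" by (intro sum.cong) auto
  also have "\<dots> = (\<Sum>k\<le>?Q. ?G k)" by (rule sum_multiples[OF m])
  also have "\<dots> = 0"
  proof -
    have "(\<Sum>k\<le>?Q. heis (- c) ?Q k * psi c (ndist k l)) = 0"
      by (rule heis_psi[where q = "n div m"]) (use c l1 lq Q in auto)
    then show ?thesis by (simp flip: sum_distrib_left)
  qed
  finally show ?thesis .
qed

lemma phi_fv:
  assumes m: "m > 0" and c: "\<And>k. 1 \<le> k \<Longrightarrow> k \<le> n div m \<Longrightarrow> c \<noteq> of_nat k"
    and ij: "i + j + Suc n = 2 * n"
  shows "(\<Sum>k\<le>Suc n. fv m c (Suc n) k * phi_mono m c n (i + k)) = 0"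
proof -
  have "(\<Sum>k\<le>Suc n. fv m c (Suc n) k * phi_mono m c n (i + k))
    = (\<Sum>k\<le>Suc n. gv m c (Suc n) k * phi_mono m c n (j + k))"
  proof (rule sum.reindex_bij_witness[of _ "\<lambda>k. Suc n - k" "\<lambda>k. Suc n - k"])
    fix k assume k: "k \<in> {..Suc n}"
    have "j + (Suc n - k) = 2 * n - (i + k)" using ij k by auto
    moreover have "i + k \<le> 2 * n" using ij k by auto
    ultimately have "phi_mono m c n (j + (Suc n - k)) = phi_mono m c n (i + k)"
      by (simp only: phi_mono_mirror)
    then show "gv m c (Suc n) (Suc n - k) * phi_mono m c n (j + (Suc n - k)) = fv m c (Suc n) k * phi_mono m c n (i + k)"
      using k by (simp add: fv_def)
  qed auto
  also have "\<dots> = 0" by (rule phi_gv[OF m c]) (use ij in auto)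
  finally show ?thesis .
qed

section \<open>Values avoided by \<open>c\<close>, and the quasi-harmonic space\<close>

lemma c_avoids:
  assumes m: "m > 0" and reg: "regular_const m c"
    and c: "\<And>k. 1 \<le> k \<Longrightarrow> k \<le> n div m \<Longrightarrow> c \<noteq> of_nat k"
    and j: "1 \<le> j" "j \<le> n"
  shows "c * of_nat m \<noteq> of_nat j"
proof (cases "m dvd j")
  case True
  then obtain k where k: "j = m * k" by auto
  have "1 \<le> k" using j k by (cases k) auto
  moreover have "k \<le> n div m" using j k m by (simp add: less_eq_div_iff_mult_less_eq mult.commute)
  ultimately show ?thesis using c[of k] m by (auto simp: k)
qed (rule regular_not_multiple[OF m reg])

text \<open>Odd \<open>Q\<close> are excluded by regularity. A positive even
  \<open>Q \<le> Suc q\<close> has its half between 1 and \<open>q\<close>, where the assumption on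
  \<open>c\<close> applies.\<close>

lemma two_c_avoids:
  assumes m: "m > 0" and reg: "regular_const m c"
    and c: "\<And>k. 1 \<le> k \<Longrightarrow> k \<le> q \<Longrightarrow> c \<noteq> of_nat k"
    and Q: "1 \<le> Q" "Q \<le> Suc q"
  shows "2 * c \<noteq> of_nat Q"
proof (cases "even Q")
  case True
  then obtain e where e: "Q = 2 * e" by auto
  then have "c \<noteq> of_nat e" using Q by (intro c) auto
  then show ?thesis by (simp add: e)
qed (rule regular_not_half[OF m reg])

lemma Suc_div_cases: "Suc n div m = (if m dvd Suc n then Suc (n div m) else n div m)"
  by (simp add: div_Suc dvd_eq_mod_eq_0)

lemma dlam_nonzero:
  assumes m: "m > 0" and reg: "regular_const m c"
    and c: "\<And>k. 1 \<le> k \<Longrightarrow> k \<le> n div m \<Longrightarrow> c \<noteq> of_nat k"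
  shows "dlam m c (Suc n) \<noteq> 0"
proof (cases "m dvd Suc n")
  case False
  then show ?thesis using regular_not_multiple[OF m reg False] by (auto simp: dlam_def)
next
  case True
  then have "Suc n = m * Suc (n div m)" by (metis Suc_div_cases dvd_mult_div_cancel)
  then have S: "of_nat (Suc n) = of_nat m * (of_nat (Suc (n div m)) :: complex)" by (metis of_nat_mult)
  have "dlam m c (Suc n) = of_nat m * (of_nat (Suc (n div m)) - 2 * c)"
    using True unfolding dlam_def S by (simp add: algebra_simps)
  moreover have "2 * c \<noteq> of_nat (Suc (n div m))"
    by (rule two_c_avoids[OF m reg c]) auto
  ultimately show ?thesis using m by simp
qed

text \<open>\<open>Ybar P\<close> lies in the kernel of \<open>Y\<close>, so it is a multiple of the
  \<open>gv\<close> of degree \<open>n\<close>. As \<open>dlam\<close> is nonzero, subtracting a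
  multiple of \<open>gv\<close> from \<open>P\<close> leaves an element of the kernel of
  \<open>Ybar\<close>, a multiple of \<open>fv\<close>.\<close>

lemma QH_span:
  assumes m: "m > 0" and reg: "regular_const m c"
    and c: "\<And>k. 1 \<le> k \<Longrightarrow> k \<le> n div m \<Longrightarrow> c \<noteq> of_nat k"
    and P: "P \<in> QH m c (Suc n)"
  shows "\<exists>s t. P = hom (Suc n) (\<lambda>a. s * fv m c (Suc n) a + t * gv m c (Suc n) a)"
proof -
  have av: "c * of_nat m \<noteq> of_nat j" if "1 \<le> j" "j \<le> n" for j
    by (rule c_avoids[OF m reg c that])
  have nm: "m dvd j \<or> c * of_nat m \<noteq> of_nat j" for j
    using regular_not_multiple[OF m reg] by blast
  obtain p where Pp: "P = hom (Suc n) p" using P homog_eq_hom by (auto simp: QH_def)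
  define r where "r = Ybc m c n p"
  have Y0: "DunklY m c (hom n r) = 0"
    using P by (simp add: QH_def DunklF_def Pp DunklYb_hom[OF m] r_def)
  obtain t' where t': "\<forall>a\<le>n. r a = t' * gv m c n a"
  proof (cases n)
    \<comment> \<open>In degree 0 every constant qualifies, and
      \<open>gv m c 0 0 = 1\<close>.\<close>
    case 0
    then show ?thesis by (intro that[of "r 0"]) (simp add: gv_def heis_def)
  next
    case (Suc N)
    have "Yc m c N r a = 0" if "a \<le> N" for a
      using Y0 that unfolding Suc DunklY_hom[OF m] hom_eq_0_iff by blast
    then have "\<exists>t. \<forall>a\<le>Suc N. r a = t * gv m c (Suc N) a"
      by (rule Yc_kernel_span[OF m _ nm]) (use av Suc in auto)
    then show ?thesis using that Suc by blast
  qed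
  define t where "t = t' / dlam m c (Suc n)"
  define p' where "p' = (\<lambda>i. 1 * p i + (- t) * gv m c (Suc n) i)"
  have "Ybc m c n p' a = 0" if "a \<le> n" for a
    unfolding p'_def Ybc_lincomb Ybc_gv[OF m that] using t' that dlam_nonzero[OF m reg c]
    by (simp add: t_def flip: r_def)
  then have "\<exists>s. \<forall>a\<le>Suc n. p' a = s * fv m c (Suc n) a"
    by (rule Ybc_kernel_span[OF m _ nm]) (use av in auto)
  then obtain s where "\<forall>a\<le>Suc n. p' a = s * fv m c (Suc n) a" ..
  then have "\<forall>a\<le>Suc n. p a = s * fv m c (Suc n) a + t * gv m c (Suc n) a"
    by (auto simp: p'_def algebra_simps)
  then show ?thesis unfolding Pp hom_eq_iff by blast
qed

lemma phi_Jideal: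
  assumes m: "m > 0" and reg: "regular_const m c"
    and c: "\<And>k. 1 \<le> k \<Longrightarrow> k \<le> n div m \<Longrightarrow> c \<noteq> of_nat k"
    and P: "P \<in> Jideal m c (Suc n)"
  shows "phi m c n P = 0"
proof -
  have "phi m c n (G * H) = 0" if H: "H \<in> QH m c (Suc n)" for G H
  proof -
    obtain s t where st: "H = hom (Suc n) (\<lambda>a. s * fv m c (Suc n) a + t * gv m c (Suc n) a)"
      using QH_span[OF m reg c H] by blast
    show ?thesis unfolding st
    proof (rule phi_mult_hom_zero)
      fix i j assume ij: "i + j + Suc n = 2 * n"
      have "(\<Sum>k\<le>Suc n. (s * fv m c (Suc n) k + t * gv m c (Suc n) k) * phi_mono m c n (i + k))
        = s * (\<Sum>k\<le>Suc n. fv m c (Suc n) k * phi_mono m c n (i + k))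
          + t * (\<Sum>k\<le>Suc n. gv m c (Suc n) k * phi_mono m c n (i + k))"
        by (simp only: sum_distrib_left distrib_right sum.distrib mult.assoc)
      then show "(\<Sum>k\<le>Suc n. (s * fv m c (Suc n) k + t * gv m c (Suc n) k) * phi_mono m c n (i + k)) = 0"
        by (simp only: phi_fv[OF m c ij] phi_gv[OF m c ij] mult_zero_right add_0)
    qed
  qed
  then show ?thesis using P by (auto simp: Jideal_def gen_ideal_def phi_sum)
qed

section \<open>The hyperplane in the top degree\<close>

text \<open>With q = Q + 1, \<open>sum_heis_rec\<close> obtains q times the two values for
  \<open>Suc Q\<close> from \<open>w * A\<close> and \<open>B\<close> by the matrix with rows (q +
  x, x) and (x, q + x). Its determinant q (q + 2 x) is nonzero, so a common zero would descend to
  \<open>Q\<close>.\<close>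

lemma heis_no_common_zero:
  assumes w: "w \<noteq> 0"
  shows "(\<And>j. 1 \<le> j \<Longrightarrow> j \<le> Q \<Longrightarrow> - 2 * x \<noteq> of_nat j) \<Longrightarrow>
    \<not> ((\<Sum>k\<le>Q. heis x Q k * w ^ (Q - k)) = 0 \<and> (\<Sum>k\<le>Q. heis x Q k * w ^ k) = 0)"
proof (induction Q)
  case 0
  then show ?case by (simp add: heis_def)
next
  case (Suc Q)
  define A where "A = (\<Sum>k\<le>Q. heis x Q k * w ^ (Q - k))"
  define B where "B = (\<Sum>k\<le>Q. heis x Q k * w ^ k)"
  have wA: "(\<Sum>k\<le>Q. heis x Q k * w ^ (Suc Q - k)) = w * A"
    unfolding A_def sum_distrib_left by (rule sum.cong) (auto simp: Suc_diff_le)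
  have wB: "(\<Sum>k\<le>Q. heis x Q k * w ^ (Suc Q - (Suc Q - k))) = B"
    unfolding B_def by (rule sum.cong) auto
  have ih: "\<not> (A = 0 \<and> B = 0)" unfolding A_def B_def by (rule Suc.IH) (use Suc.prems in auto)
  show ?case
  proof
    assume z: "(\<Sum>k\<le>Suc Q. heis x (Suc Q) k * w ^ (Suc Q - k)) = 0 \<and> (\<Sum>k\<le>Suc Q. heis x (Suc Q) k * w ^ k) = 0"
    let ?q = "of_nat (Suc Q) :: complex"
    have 1: "(?q + x) * (w * A) + x * B = 0"
      using sum_heis_rec[of Q x "\<lambda>k. w ^ (Suc Q - k)"] z unfolding wA wB by (metis mult_zero_right)
    have 2: "(?q + x) * B + x * (w * A) = 0"
      using sum_heis_rec[of Q x "\<lambda>k. w ^ k"] z unfolding wA B_def[symmetric] by (metis mult_zero_right)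
    have q: "?q \<noteq> 0" "?q + 2 * x \<noteq> 0"
    proof -
      show "?q \<noteq> 0" by (simp del: of_nat_Suc)
      show "?q + 2 * x \<noteq> 0" using Suc.prems[of "Suc Q"] by (auto simp: add_eq_0_iff2 simp del: of_nat_Suc)
    qed
    have "?q * (?q + 2 * x) * (w * A) = (?q + x) * ((?q + x) * (w * A) + x * B) - x * ((?q + x) * B + x * (w * A))"
      by (simp add: algebra_simps del: of_nat_Suc)
    then have "w * A = 0" unfolding 1 2 using q by (simp del: of_nat_Suc)
    then have A: "A = 0" using w by simp
    have "?q * (?q + 2 * x) * B = (?q + x) * ((?q + x) * B + x * (w * A)) - x * ((?q + x) * (w * A) + x * B)"
      by (simp add: algebra_simps del: of_nat_Suc)
    then have "B = 0" unfolding 1 2 using q by (simp del: of_nat_Suc)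
    with A ih show False by simp
  qed
qed

section \<open>Passage to one variable by zbar = 1\<close>

definition deh :: "nat \<Rightarrow> (nat \<Rightarrow> complex) \<Rightarrow> complex poly" where
  "deh N p = (\<Sum>a\<le>N. monom (p a) a)"

lemma coeff_deh: "coeff (deh N p) a = (if a \<le> N then p a else 0)"
  by (simp add: deh_def coeff_sum)

lemma degree_deh: "degree (deh N p) \<le> N"
  by (rule degree_le) (simp add: coeff_deh)

lemma poly_deh: "poly (deh N p) y = (\<Sum>a\<le>N. p a * y ^ a)"
  by (simp add: deh_def poly_sum poly_monom)

lemma hom_coeff_deh: "hom N (coeff (deh N p)) = hom N p"
  by (rule hom_cong) (simp add: coeff_deh)

text \<open>The first coefficient vanishes only if c = (n + 1) / m is an integer, and then the
  second one does not. This excludes the common roots 0 and infinity of the mirror pair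
  \<open>fv\<close>, \<open>gv\<close>.\<close>

lemma fg_ends:
  assumes m: "m > 0"
    and c: "\<And>k. 1 \<le> k \<Longrightarrow> k \<le> n div m \<Longrightarrow> c \<noteq> of_nat k"
  shows "gv m c (Suc n) 0 \<noteq> 0 \<or> gv m c (Suc n) (Suc n) \<noteq> 0"
proof (rule ccontr)
  assume n: "\<not> ?thesis"
  then obtain i where i: "i < Suc n div m" "1 - c = - of_nat i" by (auto simp: gv_bot hc_nonzero_iff)
  then have ci: "c = of_nat (Suc i)" by (simp add: algebra_simps)
  then have "\<not> Suc i \<le> n div m" using c[of "Suc i"] by auto
  then have dv: "m dvd Suc n" and "i = n div m" using i unfolding Suc_div_cases by (auto split: if_splits)
  then have "c = of_nat (Suc n div m)" by (simp add: ci Suc_div_cases)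
  then have "gv m c (Suc n) (Suc n) \<noteq> 0" by (auto simp: gv_top[OF m dv] hc_nonzero_iff)
  then show False using n by simp
qed

text \<open>For \<open>y \<noteq> 0\<close> the second polynomial is a Heisenberg sum in
  \<open>w = (- y) ^ m\<close>, and the first is the reversed sum up to a nonzero factor, so
  \<open>heis_no_common_zero\<close> applies. At \<open>y = 0\<close> the end coefficients
  decide.\<close>

lemma fg_no_common_root:
  assumes m: "m > 0" and reg: "regular_const m c"
    and c: "\<And>k. 1 \<le> k \<Longrightarrow> k \<le> n div m \<Longrightarrow> c \<noteq> of_nat k"
    and f: "poly (deh (Suc n) (fv m c (Suc n))) y = 0" and g: "poly (deh (Suc n) (gv m c (Suc n))) y = 0"
  shows False
proof (cases "y = 0")
  case True
  have "poly (deh (Suc n) p) 0 = p 0" for p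
    by (simp add: poly_0_coeff_0 coeff_deh)
  then show False using f g True fg_ends[OF m c] by (auto simp: fv_def)
next
  case False
  let ?Q = "Suc n div m" and ?h = "heis (- c) (Suc n div m)"
  define w where "w = (- y) ^ m"
  have w: "w \<noteq> 0" using False by (simp add: w_def)
  have wk: "(-1) ^ (m * k) * y ^ (m * k) = w ^ k" for k
    by (simp add: w_def power_mult flip: power_mult_distrib)
  have "poly (deh (Suc n) (gv m c (Suc n))) y = (\<Sum>a\<le>Suc n. if m dvd a then ?h (a div m) * w ^ (a div m) else 0)"
    unfolding poly_deh
  proof (rule sum.cong)
    fix a assume "a \<in> {..Suc n}"
    then show "gv m c (Suc n) a * y ^ a = (if m dvd a then ?h (a div m) * w ^ (a div m) else 0)"
      using wk[of "a div m"] by (auto simp: gv_def algebra_simps)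
  qed simp
  then have B: "(\<Sum>k\<le>?Q. ?h k * w ^ k) = 0"
    using g sum_multiples[OF m, of "\<lambda>k. ?h k * w ^ k"] by simp
  have "y ^ (Suc n - m * ?Q) * (\<Sum>k\<le>?Q. ?h k * w ^ (?Q - k)) * (-1) ^ (m * ?Q) = poly (deh (Suc n) (fv m c (Suc n))) y"
  proof -
    have "poly (deh (Suc n) (fv m c (Suc n))) y = (\<Sum>a\<le>Suc n. gv m c (Suc n) a * y ^ (Suc n - a))"
      unfolding poly_deh
      by (rule sum.reindex_bij_witness[of _ "\<lambda>k. Suc n - k" "\<lambda>k. Suc n - k"]) (auto simp: fv_def)
    also have "\<dots> = (\<Sum>a\<le>Suc n. if m dvd a then y ^ (Suc n - m * ?Q) * (?h (a div m) * w ^ (?Q - a div m)) * (-1) ^ (m * ?Q) else 0)"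
    proof (rule sum.cong)
      fix a assume a: "a \<in> {..Suc n}"
      show "gv m c (Suc n) a * y ^ (Suc n - a) = (if m dvd a then y ^ (Suc n - m * ?Q) * (?h (a div m) * w ^ (?Q - a div m)) * (-1) ^ (m * ?Q) else 0)"
      proof (cases "m dvd a")
        case True
        then obtain k where k: "a = m * k" by auto
        have kQ: "k \<le> ?Q" using a k m by (simp add: less_eq_div_iff_mult_less_eq mult.commute)
        then have mk: "m * k + m * (?Q - k) = m * ?Q" by (simp flip: distrib_left)
        have mQ: "m * ?Q \<le> Suc n" by simp
        have "Suc n - a = (Suc n - m * ?Q) + m * (?Q - k)" using mk mQ k by linarith
        then have e1: "y ^ (Suc n - a) = y ^ (Suc n - m * ?Q) * y ^ (m * (?Q - k))" by (simp only: power_add)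
        have e2: "(-1::complex) ^ (m * ?Q) = (-1) ^ (m * k) * (-1) ^ (m * (?Q - k))"
          by (simp only: power_add[symmetric] mk)
        have e3: "(-1::complex) ^ (m * (?Q - k)) * (-1) ^ (m * (?Q - k)) = 1" by (simp flip: power_mult_distrib)
        have gk: "gv m c (Suc n) a = (-1) ^ (m * k) * ?h k" using a m by (simp add: gv_def k)
        have ak: "a div m = k" using k m by simp
        have "y ^ (Suc n - m * ?Q) * (?h k * w ^ (?Q - k)) * (-1) ^ (m * ?Q)
          = (-1) ^ (m * k) * ?h k * (y ^ (Suc n - m * ?Q) * y ^ (m * (?Q - k)))
            * ((-1) ^ (m * (?Q - k)) * (-1) ^ (m * (?Q - k)))"
          unfolding wk[of "?Q - k", symmetric] e2 by (simp only: mult_ac)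
        then show ?thesis unfolding e1 e3 gk ak if_P[OF True] by (simp only: mult_1_right)
      qed (simp add: gv_def)
    qed simp
    also have "\<dots> = (\<Sum>k\<le>?Q. y ^ (Suc n - m * ?Q) * (?h k * w ^ (?Q - k)) * (-1) ^ (m * ?Q))"
      by (rule sum_multiples[OF m])
    finally show ?thesis by (simp only: sum_distrib_left sum_distrib_right)
  qed
  then have A: "(\<Sum>k\<le>?Q. ?h k * w ^ (?Q - k)) = 0" using f False by auto
  have "\<not> ((\<Sum>k\<le>?Q. ?h k * w ^ (?Q - k)) = 0 \<and> (\<Sum>k\<le>?Q. ?h k * w ^ k) = 0)"
  proof (rule heis_no_common_zero[OF w])
    fix j assume "1 \<le> j" "j \<le> ?Q"
    then have "2 * c \<noteq> of_nat j"
      by (intro two_c_avoids[OF m reg c]) (auto simp: Suc_div_cases split: if_splits)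
    then show "- 2 * - c \<noteq> of_nat j" by simp
  qed
  then show False using A B by simp
qed

text \<open>Over the complex numbers a nonconstant gcd would have a root.\<close>

lemma bezout_no_common_root:
  fixes f g :: "complex poly"
  assumes "\<And>y. poly f y = 0 \<Longrightarrow> poly g y \<noteq> 0"
  shows "\<exists>u v. u * f + v * g = 1"
proof -
  have "degree (gcd f g) = 0"
  proof (rule ccontr)
    assume "degree (gcd f g) \<noteq> 0"
    then obtain y where "poly (gcd f g) y = 0"
      using fundamental_theorem_of_algebra constant_degree by metis
    then have "poly f y = 0" "poly g y = 0"
      by (metis dvd_trans gcd_dvd1 gcd_dvd2 poly_eq_0_iff_dvd)+
    then show False using assms by blast
  qed
  moreover have "gcd f g \<noteq> 0" using assms by auto
  ultimately have "is_unit (gcd f g)" using is_unit_iff_degree by blast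
  then have "gcd f g = 1" by (metis is_unit_gcd_iff coprime_iff_gcd_eq_1)
  then show ?thesis using bezout_coefficients_fst_snd[of f g] by metis
qed

text \<open>Division by \<open>f\<close> writes every \<open>h\<close> of degree at most \<open>2n\<close> as \<open>u f + v g\<close> with
  \<open>degree v \<le> n\<close>, and the coefficient of \<open>v\<close> at \<open>n\<close> is the only obstruction to
  \<open>u\<close> and \<open>v\<close> having degree less than \<open>n\<close>. So that coefficient has to vanish on the kernel of
  any nonzero functional that kills the unobstructed combinations.\<close>
lemma hyperplane_spanned:
  fixes f g h h0 :: "complex poly" and F :: "complex poly \<Rightarrow> complex"
  assumes root: "\<And>y. poly f y = 0 \<Longrightarrow> poly g y \<noteq> 0"
    and df: "degree f = Suc n" and dg: "degree g \<le> Suc n"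
    and lin: "\<And>s p q. F (p - smult s q) = F p - s * F q"
    and kill: "\<And>u v. \<forall>i\<ge>n. coeff u i = 0 \<Longrightarrow> \<forall>i\<ge>n. coeff v i = 0 \<Longrightarrow> F (u * f + v * g) = 0"
    and h0: "degree h0 \<le> 2 * n" "F h0 \<noteq> 0"
    and h: "degree h \<le> 2 * n" "F h = 0"
  shows "\<exists>u v. (\<forall>i\<ge>n. coeff u i = 0) \<and> (\<forall>i\<ge>n. coeff v i = 0) \<and> h = u * f + v * g"
proof -
  have f0: "f \<noteq> 0" using df by auto
  \<comment> \<open>A Bezout relation is multiplied by \<open>p\<close>; the coefficient of
    \<open>g\<close> is then reduced modulo \<open>f\<close>, and the quotient moves to the
    coefficient of \<open>f\<close>.\<close>
  have rep: "\<exists>u v. degree v \<le> n \<and> p = u * f + v * g" for p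
  proof -
    obtain U V where UV: "U * f + V * g = 1" using bezout_no_common_root[OF root] by blast
    have "p = p * (U * f + V * g)" by (simp add: UV)
    also have "\<dots> = p * U * f + (p * V) * g" by (simp add: algebra_simps)
    also have "p * V = (p * V) div f * f + (p * V) mod f" by simp
    finally have "p = (p * U + (p * V) div f * g) * f + (p * V) mod f * g"
      by (simp only: distrib_right mult.assoc mult.commute[of f g] add.assoc)
    moreover have "degree ((p * V) mod f) \<le> n" using degree_mod_less'[of f "p * V"] f0 df
      by (cases "(p * V) mod f = 0") auto
    ultimately show ?thesis by blast
  qed
  have small: "(\<forall>i\<ge>n. coeff u i = 0) \<and> (\<forall>i\<ge>n. coeff v i = 0)"
    if d: "degree (u * f + v * g) \<le> 2 * n" and v: "degree v \<le> n" "coeff v n = 0" for u v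
  proof -
    have v': "\<forall>i\<ge>n. coeff v i = 0"
      using v by (metis coeff_eq_0 le_neq_implies_less le_less_trans)
    have "degree (v * g) \<le> 2 * n"
    proof (cases "v = 0")
      case False
      then have "degree v < n" using v' by (metis leading_coeff_0_iff linorder_not_le)
      then show ?thesis using degree_mult_le[of v g] dg by linarith
    qed simp
    then have "degree (u * f) \<le> 2 * n"
      using d degree_diff_le[of "u * f + v * g" "2 * n" "v * g"] by simp
    then have "u = 0 \<or> degree u < n" using f0 df by (cases "u = 0") (auto simp: degree_mult_eq)
    then show ?thesis using v' by (auto simp: coeff_eq_0)
  qed
  obtain u v where uv: "degree v \<le> n" "h = u * f + v * g" using rep by blast
  obtain u' v' where uv': "degree v' \<le> n" "h0 = u' * f + v' * g" using rep by blast
  have "coeff v n = 0"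
  proof (rule ccontr)
    assume nz: "coeff v n \<noteq> 0"
    \<comment> \<open>This \<open>s\<close> removes the obstruction from
      \<open>h0 - smult s h\<close>, so \<open>F\<close> kills it, although \<open>F h = 0\<close>
      and \<open>F h0 \<noteq> 0\<close>.\<close>
    define s where "s = coeff v' n / coeff v n"
    have e: "h0 - smult s h = (u' - smult s u) * f + (v' - smult s v) * g"
      unfolding uv uv' by (simp add: algebra_simps smult_add_right)
    have "degree (h0 - smult s h) \<le> 2 * n" using h(1) h0(1) degree_smult_le[of s h] by (intro degree_diff_le) auto
    then have "(\<forall>i\<ge>n. coeff (u' - smult s u) i = 0) \<and> (\<forall>i\<ge>n. coeff (v' - smult s v) i = 0)"
      using uv(1) uv'(1) degree_smult_le[of s v] nz unfolding e
      by (intro small degree_diff_le) (auto simp: s_def)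
    then have "F (h0 - smult s h) = 0" unfolding e by (intro kill) auto
    then show False using lin h h0 by simp
  qed
  then show ?thesis using small[of u v] uv h(1) by blast
qed

lemma hom_in_gen_ideal:
  assumes "hom (Suc n) (coeff f) \<in> S" "hom (Suc n) (coeff g) \<in> S" "degree f \<le> Suc n" "degree g \<le> Suc n"
    and u: "\<forall>i\<ge>n. coeff u i = 0" and v: "\<forall>i\<ge>n. coeff v i = 0"
  shows "hom (2 * n) (coeff (u * f + v * g)) \<in> gen_ideal S"
proof (cases n)
  case 0
  \<comment> \<open>There are no multipliers of degree \<open>n - 1\<close> here, so the combination
    is empty.\<close>
  then have "u = 0" "v = 0" using u v by (auto simp: poly_eq_iff)
  then have "hom (2 * n) (coeff (u * f + v * g)) = (\<Sum>i<0::nat. 0 * 0)"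
    using hom_zero[of "2 * n"] by (simp add: zero_poly.rep_eq)
  then show ?thesis unfolding gen_ideal_def
    by (intro CollectI exI[of _ "0::nat"] exI[of _ "\<lambda>_. 0"]) simp
next
  case (Suc N)
  have du: "degree u \<le> N" and dv: "degree v \<le> N" using u v Suc by (auto intro!: degree_le)
  have "hom (2 * n) (coeff (u * f + v * g)) = hom (N + Suc n) (coeff (u * f)) + hom (N + Suc n) (coeff (v * g))"
    using Suc by (simp add: hom_add hom_eq_iff mult_2)
  also have "\<dots> = (\<Sum>i<2::nat. (if i = 0 then hom N (coeff u) else hom N (coeff v)) *
      (if i = 0 then hom (Suc n) (coeff f) else hom (Suc n) (coeff g)))"
    by (simp add: hom_mult_coeff du dv assms numeral_2_eq_2)
  finally show ?thesis unfolding gen_ideal_def using assms(1,2)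
    by (intro CollectI exI[of _ "2::nat"] exI[of _ "\<lambda>i. if i = 0 then hom N (coeff u) else hom N (coeff v)"]
        exI[of _ "\<lambda>i. if i = 0 then hom (Suc n) (coeff f) else hom (Suc n) (coeff g)"]) auto
qed

lemma Jideal_if_phi_zero:
  assumes m: "m > 0" and reg: "regular_const m c"
    and c: "\<And>k. 1 \<le> k \<Longrightarrow> k \<le> n div m \<Longrightarrow> c \<noteq> of_nat k"
    and P: "homog (2 * n) P" "phi m c n P = 0"
  shows "P \<in> Jideal m c (Suc n)"
proof -
  define f where "f = deh (Suc n) (fv m c (Suc n))"
  define g where "g = deh (Suc n) (gv m c (Suc n))"
  define F where "F = (\<lambda>h. phi m c n (hom (2 * n) (coeff h)))"
  define h where "h = deh (2 * n) (\<lambda>a. cf2 P a (2 * n - a))"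
  have hP: "hom (2 * n) (coeff h) = P"
    unfolding h_def hom_coeff_deh by (rule homog_eq_hom[OF P(1), symmetric])
  have root: "\<not> (poly f y = 0 \<and> poly g y = 0)" for y
    unfolding f_def g_def using fg_no_common_root[OF m reg c] by blast
  have dfg: "degree f \<le> Suc n" "degree g \<le> Suc n" by (simp_all add: f_def g_def degree_deh)
  have QH: "hom (Suc n) (coeff f) \<in> QH m c (Suc n)" "hom (Suc n) (coeff g) \<in> QH m c (Suc n)"
    by (simp_all add: f_def g_def hom_coeff_deh fv_in_QH[OF m] gv_in_QH[OF m])
  have lin: "F (p - smult s q) = F p - s * F q" for s p q
    unfolding F_def phi_hom by (simp add: sum_subtractf sum_distrib_left algebra_simps)
  have J: "hom (2 * n) (coeff (u * f + v * g)) \<in> Jideal m c (Suc n)"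
    if "\<forall>i\<ge>n. coeff u i = 0" "\<forall>i\<ge>n. coeff v i = 0" for u v
    unfolding Jideal_def by (rule hom_in_gen_ideal[OF QH dfg that])
  have kill: "F (u * f + v * g) = 0" if "\<forall>i\<ge>n. coeff u i = 0" "\<forall>i\<ge>n. coeff v i = 0" for u v
    unfolding F_def by (rule phi_Jideal[OF m reg c J[OF that]])
  \<comment> \<open>The polynomial outside the hyperplane is z^n zbar^n, where the functional is
    1.\<close>
  have "F (monom 1 n) = (\<Sum>a\<le>2 * n. if a = n then phi_mono m c n n else 0)"
    unfolding F_def phi_hom by (rule sum.cong) auto
  then have F1: "F (monom 1 n) \<noteq> 0" by (simp add: phi_mono_def)
  have d1: "degree (monom (1::complex) n) \<le> 2 * n" using degree_monom_le[of "1::complex" n] by simp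
  have dh: "degree h \<le> 2 * n" by (simp add: h_def degree_deh)
  have Fh: "F h = 0" using P by (simp add: F_def hP)
  \<comment> \<open>\<open>hyperplane_spanned\<close> divides by a polynomial of exact degree
    \<open>Suc n\<close>. One of \<open>f\<close> and \<open>g\<close> has it, and their roles are
    swapped if it is \<open>g\<close>.\<close>
  have "coeff f (Suc n) \<noteq> 0 \<or> coeff g (Suc n) \<noteq> 0"
    using fg_ends[OF m c] by (simp add: f_def g_def coeff_deh fv_def)
  then have "\<exists>u v. (\<forall>i\<ge>n. coeff u i = 0) \<and> (\<forall>i\<ge>n. coeff v i = 0) \<and> h = u * f + v * g"
  proof
    assume "coeff f (Suc n) \<noteq> 0"
    then have "degree f = Suc n" using dfg le_degree by (metis le_antisym)
    from hyperplane_spanned[OF _ this dfg(2) lin kill d1 F1 dh Fh] show ?thesis using root by blast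
  next
    assume "coeff g (Suc n) \<noteq> 0"
    then have dg: "degree g = Suc n" using dfg le_degree by (metis le_antisym)
    have kill': "F (v * g + u * f) = 0" if "\<forall>i\<ge>n. coeff v i = 0" "\<forall>i\<ge>n. coeff u i = 0" for u v
      using kill[OF that(2,1)] by (simp only: add.commute)
    from hyperplane_spanned[OF _ dg dfg(1) lin kill' d1 F1 dh Fh]
    have "\<exists>v u. (\<forall>i\<ge>n. coeff v i = 0) \<and> (\<forall>i\<ge>n. coeff u i = 0) \<and> h = v * g + u * f"
      using root by blast
    then show ?thesis by (metis add.commute)
  qed
  then show ?thesis using J hP by metis
qed

theorem theorem2p26:
  fixes m n :: nat and c :: complex
  assumes "m \<ge> 2"
    and "regular_const m c"
    and "\<forall>k::nat. 1 \<le> k \<and> k \<le> n div m \<longrightarrow> c \<noteq> of_nat k"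
  shows "{P. homog (2 * n) P \<and> P \<in> Jideal m c (n + 1)} =
         {P. homog (2 * n) P \<and> phi m c n P = 0}"
  using phi_Jideal[of m c n] Jideal_if_phi_zero[of m c n] assms by auto

end
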